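(* Let $\Omega\subset\mathbb{R}^d$ be open and bounded, $Y$ a Hilbert space, $y\in Y$, $m\in\{0,1\}$ and $c>0$. Assume that $A:L^1(\Omega)\to Y$ is a bounded linear operator which satisfies, for some $\gamma>0$, $$\|Au-Av\|\le\gamma\sqrt{d(u,v)}\quad\text{on }\mathrm{dom}(f+\chi_m),$$ and, in the case $m=0$, is such that $D(u,v)\ge 0$ for all $u\in\mathrm{dom}\,f$ and $v\in\mathrm{dom}\,\partial f$. Assume that the operator equation $Au=y$ has a positive solution $z$, verifying $\chi_m(z)=0$ if $m=1$. Let $y^\delta\in Y$ be noisy data satisfying $\|y-y^\delta\|\le\delta$, for some noise level $\delta$. Let $u_0\in\mathrm{dom}\,\partial f$ be an arbitrary starting element with the properties $1+\ln u_0\in\mathcal{R}(A^* )$ and $\chi_m(u_0)=0$ if $m=1$. Let $\{u_k\}$ be the iterates (depending on $\delta$) defined by $$u_{k+1}\in\arg\min_{u\in\mathrm{dom}\,f}\left\{\langle Au-y^\delta,Au_k-y^\delta\rangle+c\,d(u,u_k)+\chi_m(u)\right\},\quad k=0,1,2,\dots$$ Let the stopping index $k_*(\delta)$ be chosen of order $1/\delta$. Then $\{f(u_{k_*(\delta)})\}_\delta$ is bounded and hence, as $\delta\to0$, there exists a weakly convergent subsequence $\{u_{k_*(\delta_n)}\}_n$ in $L^1(\Omega)$ whose limit is a solution of $Au=y$. Moreover, if the solution of the equation is unique, then $\{u_{k_*(\delta)}\}_{\delta>0}$ converges weakly to the solution as $\delta\to0$.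
   Context: $f:L^1(\Omega)\to(-\infty,+\infty]$ is the negative of the Boltzmann-Shannon entropy: $f(u)=\int_\Omega u(t)\ln u(t)\,dt$ if $u\ge 0$ a.e. and $u\ln u\in L^1(\Omega)$, and $f(u)=+\infty$ otherwise (with $0\ln 0=0$). $\mathrm{dom}\,f=\{u\in L^1(\Omega): f(u)<\infty\}$. $\mathrm{dom}\,\partial f$ denotes the set of nonnegative $u\in L^1(\Omega)$ that are bounded and bounded away from zero a.e. For $v,u\in\mathrm{dom}\,f$, $d(v,u)\in[0,+\infty]$ is the Kullback-Leibler divergence (the Bregman distance of $f$), given, when finite, by $d(v,u)=\int_\Omega\big[v(t)\ln\frac{v(t)}{u(t)}-v(t)+u(t)\big]dt$. $\chi_0\equiv 0$; $\chi_1(u)=0$ if $\int_\Omega u(t)\,dt=1$ and $\chi_1(u)=+\infty$ otherwise; $\mathrm{dom}(f+\chi_m)=\{u: f(u)+\chi_m(u)<\infty\}$. $D(u,v)=c\,d(u,v)-\frac12\|Au-Av\|^2$. In the case $m=1$, $D(u,v)\ge0$ for $u,v\in\mathrm{dom}(f+\chi_1)$, $v\in\mathrm{dom}\,\partial f$, whenever $c\ge\gamma^2/2$. $A^*:Y\to L^\infty(\Omega)$ is the adjoint of $A$ and $\mathcal{R}(A^* )$ its range. With $\lambda=1/c$, the minimizer in each step exists, is unique, lies in $\mathrm{dom}\,\partial f$, and equals $u_{k+1}=u_k c_k^m e^{\lambda A^*(y^\delta-Au_k)}$ with $c_k^0=1$ and $c_k^1=1/\int_\Omega u_k e^{\lambda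 A^*(y^\delta-Au_k)}dt$. "$k_*(\delta)$ of order $1/\delta$" means $k_*(\delta)\sim 1/\delta$, i.e. $k_*(\delta)$ is bounded above and below by positive constant multiples of $1/\delta$.
   Formalization: In the case m=1 the condition c ≥ γ²/2 is assumed, and the positive solution z is assumed to lie in dom f; without these the claim fails. Noise levels range over (0, δ₀], where k_*(δ) is of order 1/δ. *)

theory Defs
  imports "HOL-Analysis.Analysis"
begin

text \<open>
  Elements of $L^1(\Omega)$ and $L^\infty(\Omega)$ are represented by functions; two functions
  represent the same element iff they agree almost everywhere on \<open>\<Omega>\<close>.
\<close>

definition L1 :: "'a::euclidean_space set \<Rightarrow> ('a \<Rightarrow> real) set" where
  "L1 \<Omega> = {u. integrable (lebesgue_on \<Omega>) u}"

definition Linf :: "'a::euclidean_space set \<Rightarrow> ('a \<Rightarrow> real) set" where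
  "Linf \<Omega> = {g \<in> borel_measurable (lebesgue_on \<Omega>).
              \<exists>C. AE t in lebesgue_on \<Omega>. \<bar>g t\<bar> \<le> C}"

text \<open>
  The norm bound makes \<open>A\<close> respect almost-everywhere equality, so \<open>A\<close> descends to the space of
  equivalence classes. Its values outside \<open>L1 \<Omega>\<close> are irrelevant.
\<close>

definition bounded_linear_L1 ::
    "'a::euclidean_space set \<Rightarrow> (('a \<Rightarrow> real) \<Rightarrow> 'b::real_normed_vector) \<Rightarrow> bool" where
  "bounded_linear_L1 \<Omega> A \<longleftrightarrow>
     (\<forall>u\<in>L1 \<Omega>. \<forall>v\<in>L1 \<Omega>. A (\<lambda>t. u t + v t) = A u + A v) \<and>
     (\<forall>r. \<forall>u\<in>L1 \<Omega>. A (\<lambda>t. r * u t) = r *\<^sub>R A u) \<and>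
     (\<exists>K. \<forall>u\<in>L1 \<Omega>. norm (A u) \<le> K * (\<integral>t. \<bar>u t\<bar> \<partial>lebesgue_on \<Omega>))"

text \<open>Convergence against every element of the dual of $L^1(\Omega)$, along an arbitrary filter.\<close>

definition weakly_converges_L1 ::
    "'a::euclidean_space set \<Rightarrow> ('i \<Rightarrow> 'a \<Rightarrow> real) \<Rightarrow> ('a \<Rightarrow> real) \<Rightarrow> 'i filter \<Rightarrow> bool" where
  "weakly_converges_L1 \<Omega> v u F \<longleftrightarrow>
     u \<in> L1 \<Omega> \<and> (\<forall>\<^sub>F i in F. v i \<in> L1 \<Omega>) \<and>
     (\<forall>\<phi> :: ('a \<Rightarrow> real) \<Rightarrow> real. bounded_linear_L1 \<Omega> \<phi> \<longrightarrow> ((\<lambda>i. \<phi> (v i)) \<longlongrightarrow> \<phi> u) F)"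

text \<open>\<open>g\<close> represents the element $A^* w$ of $L^\infty(\Omega)$, the dual of $L^1(\Omega)$.\<close>

definition is_adjoint_value ::
    "'a::euclidean_space set \<Rightarrow> (('a \<Rightarrow> real) \<Rightarrow> 'y::real_inner) \<Rightarrow> 'y \<Rightarrow> ('a \<Rightarrow> real) \<Rightarrow> bool" where
  "is_adjoint_value \<Omega> A w g \<longleftrightarrow>
     g \<in> Linf \<Omega> \<and> (\<forall>u\<in>L1 \<Omega>. (\<integral>t. g t * u t \<partial>lebesgue_on \<Omega>) = w \<bullet> A u)"

definition range_adjoint ::
    "'a::euclidean_space set \<Rightarrow> (('a \<Rightarrow> real) \<Rightarrow> 'y::real_inner) \<Rightarrow> ('a \<Rightarrow> real) set" where
  "range_adjoint \<Omega> A = {g. \<exists>w. is_adjoint_value \<Omega> A w g}"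

text \<open>The convention $0 \ln 0 = 0$ holds automatically, since \<open>0 * x = 0\<close>.\<close>

definition neg_entropy :: "'a::euclidean_space set \<Rightarrow> ('a \<Rightarrow> real) \<Rightarrow> ereal" where
  "neg_entropy \<Omega> u =
     (if (AE t in lebesgue_on \<Omega>. 0 \<le> u t) \<and> integrable (lebesgue_on \<Omega>) (\<lambda>t. u t * ln (u t))
      then ereal (\<integral>t. u t * ln (u t) \<partial>lebesgue_on \<Omega>) else \<infinity>)"

definition dom_f :: "'a::euclidean_space set \<Rightarrow> ('a \<Rightarrow> real) set" where
  "dom_f \<Omega> = {u \<in> L1 \<Omega>. neg_entropy \<Omega> u < \<infinity>}"

definition dom_subdiff_f :: "'a::euclidean_space set \<Rightarrow> ('a \<Rightarrow> real) set" where
  "dom_subdiff_f \<Omega> =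
     {u \<in> L1 \<Omega>. \<exists>a>0. \<exists>b. AE t in lebesgue_on \<Omega>. a \<le> u t \<and> u t \<le> b}"

definition chi :: "'a::euclidean_space set \<Rightarrow> nat \<Rightarrow> ('a \<Rightarrow> real) \<Rightarrow> ereal" where
  "chi \<Omega> m u = (if m = 0 \<or> (\<integral>t. u t \<partial>lebesgue_on \<Omega>) = 1 then 0 else \<infinity>)"

definition dom_f_chi :: "'a::euclidean_space set \<Rightarrow> nat \<Rightarrow> ('a \<Rightarrow> real) set" where
  "dom_f_chi \<Omega> m = {u \<in> L1 \<Omega>. neg_entropy \<Omega> u + chi \<Omega> m u < \<infinity>}"

text \<open>
  For $v, u \ge 0$ the integrand $v \ln (v/u) - v + u$ of the Kullback-Leibler divergence is
  nonnegative. Where $u = 0$ it is read as $0$ if $v = 0$ and as $+\infty$ if $v > 0$; these are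
  the values of the pointwise Bregman distance of $s \mapsto s \ln s$, with the one-sided
  directional derivative at $0$. The divergence is therefore a well-defined element of
  $[0, +\infty]$, and it is the ordinary integral whenever it is finite.
\<close>

definition kl_integrand :: "real \<Rightarrow> real \<Rightarrow> ennreal" where
  "kl_integrand v u =
     (if 0 < u then ennreal (v * ln (v / u) - v + u) else if v = 0 then 0 else \<infinity>)"

definition KL :: "'a::euclidean_space set \<Rightarrow> ('a \<Rightarrow> real) \<Rightarrow> ('a \<Rightarrow> real) \<Rightarrow> ennreal" where
  "KL \<Omega> v u = (\<integral>\<^sup>+t. kl_integrand (v t) (u t) \<partial>lebesgue_on \<Omega>)"

definition D_functional ::
    "'a::euclidean_space set \<Rightarrow> (('a \<Rightarrow> real) \<Rightarrow> 'y::real_inner) \<Rightarrow> real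
      \<Rightarrow> ('a \<Rightarrow> real) \<Rightarrow> ('a \<Rightarrow> real) \<Rightarrow> ereal" where
  "D_functional \<Omega> A c u v =
     ereal c * enn2ereal (KL \<Omega> u v) - ereal ((norm (A u - A v))\<^sup>2 / 2)"

definition step_objective ::
    "'a::euclidean_space set \<Rightarrow> (('a \<Rightarrow> real) \<Rightarrow> 'y::real_inner) \<Rightarrow> nat \<Rightarrow> real \<Rightarrow> 'y
      \<Rightarrow> ('a \<Rightarrow> real) \<Rightarrow> ('a \<Rightarrow> real) \<Rightarrow> ereal" where
  "step_objective \<Omega> A m c yd uk u =
     ereal ((A u - yd) \<bullet> (A uk - yd)) + ereal c * enn2ereal (KL \<Omega> u uk) + chi \<Omega> m u"

text \<open>
  Minimizers are unique only up to almost-everywhere equality, so the iterates are characterized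
  by a predicate that allows any representative at each step.
\<close>

definition is_iterates ::
    "'a::euclidean_space set \<Rightarrow> (('a \<Rightarrow> real) \<Rightarrow> 'y::real_inner) \<Rightarrow> nat \<Rightarrow> real \<Rightarrow> 'y
      \<Rightarrow> ('a \<Rightarrow> real) \<Rightarrow> (nat \<Rightarrow> 'a \<Rightarrow> real) \<Rightarrow> bool" where
  "is_iterates \<Omega> A m c yd u0 u \<longleftrightarrow>
     u 0 = u0 \<and>
     (\<forall>k. is_arg_min (step_objective \<Omega> A m c yd (u k)) (\<lambda>v. v \<in> dom_f \<Omega>) (u (Suc k)))"

text \<open>
  On an interval $(0, \delta_0]$: since \<open>k \<delta>\<close> is a natural number, the two-sided bound cannot
  hold for all large \<open>\<delta>\<close>.
\<close>

definition of_order_inverse :: "real \<Rightarrow> (real \<Rightarrow> nat) \<Rightarrow> bool" where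
  "of_order_inverse \<delta>0 k \<longleftrightarrow>
     (\<exists>a>0. \<exists>b>0. \<forall>\<delta>\<in>{0<..\<delta>0}. a * (1 / \<delta>) \<le> real (k \<delta>) \<and> real (k \<delta>) \<le> b * (1 / \<delta>))"

end

theory Submission
  imports Defs "HOL-Complex_Analysis.Great_Picard"
begin

text \<open>
  Each step multiplies the iterate by \<open>e^(A* r_k / c + \<beta>)\<close> with \<open>r_k = y^\<delta> - A u_k\<close>, so the three-point
  identity for the Kullback-Leibler divergence together with \<open>D \<ge> 0\<close> shows that the residuals decrease
  and that \<open>c d(z, u_n) + 1/2 \<Sum> |r_k|^2\<close>, summed over \<open>1 \<le> k \<le> n\<close>, is at most
  \<open>c d(z, u_0) + n \<delta>^2 / 2\<close>. For \<open>n\<close> of order \<open>1 / \<delta>\<close>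
  this yields \<open>|r_n|^2 = O(\<delta>)\<close>. Since \<open>1 + ln u_n = A* w_n + const\<close> with
  \<open>w_n = w_0 + (1/c) \<Sum> r_k\<close>, the difference \<open>f(u_n) - f(z)\<close> equals \<open>\<langle>w_n, A u_n - y\<rangle> - d(z, u_n)\<close>, in which
  the growth of \<open>w_n\<close> like \<open>n^(1/2)\<close> is compensated by the decay of the residual. Bounded entropy gives
  uniform integrability, hence weak sequential compactness in \<open>L^1\<close>.
\<close>

subsection \<open>The dual of $L^1$ and weak compactness\<close>

text \<open>A norm bound yields no weakly convergent subsequence in L^1, which is why a bound on
  f(u_n) is the target. The estimate of d(z, u_n) does not provide it: in its second argument the
  divergence grows only linearly at large values. The source condition on \<open>u0\<close> closes
  the gap: up to mass terms it turns the integral of (u_n - z) ln u_n into a pairing of w_n with A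
  u_n - y, which residual and noise control. The two sides of the order 1/\<delta> do separate work.
  An upper bound on n \<delta> keeps the accumulated noise n \<delta>^2 bounded; a lower bound turns
  |r_n|^2 = O(1/n) into O(\<delta>), so that weak limits solve the equation. For m = 1 the constants
  in ln u_n are never estimated: they multiply a difference of two masses that are both 1. Since
  minimizers are known only up to null sets, ln u_n and A* w_n are compared through integrals
  against L^1 functions.\<close>

text \<open>Absolute continuity forces continuity at the empty set, which upgrades finite to
  countable additivity; Radon-Nikodym then gives the density. The hypotheses are properties that
  pass to setwise limits when the modulus is uniform.\<close>

lemma (in finite_measure) abs_continuous_set_function_density:
  fixes \<nu> :: "'a set \<Rightarrow> real"
  assumes nonneg: "\<And>E. E \<in> sets M \<Longrightarrow> 0 \<le> \<nu> E"
    and add: "\<And>E F. E \<in> sets M \<Longrightarrow> F \<in> sets M \<Longrightarrow> E \<inter> F = {} \<Longrightarrow> \<nu> (E \<union> F) = \<nu> E + \<nu> F"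
    and ac: "\<And>e. 0 < e \<Longrightarrow> \<exists>d>0. \<forall>E\<in>sets M. measure M E < d \<longrightarrow> \<nu> E < e"
  obtains h where "integrable M h" "\<And>x. 0 \<le> h x"
    "\<And>E. E \<in> sets M \<Longrightarrow> \<nu> E = (\<integral>x. h x * indicator E x \<partial>M)"
proof -
  have null: "\<nu> E = 0" if "E \<in> sets M" "measure M E = 0" for E
  proof -
    have "\<nu> E \<le> 0 + e" if "0 < e" for e
      using ac[OF \<open>0 < e\<close>] \<open>E \<in> sets M\<close> \<open>measure M E = 0\<close> by (metis add_0 less_eq_real_def)
    then show ?thesis
      using nonneg[OF \<open>E \<in> sets M\<close>] field_le_epsilon by (meson order_antisym)
  qed
  define N where "N = measure_of (space M) (sets M) (\<lambda>E. ennreal (\<nu> E))"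
  have sets_N: "sets N = sets M" and space_N: "space N = space M"
    unfolding N_def by auto
  have "countably_additive (sets M) (\<lambda>E. ennreal (\<nu> E))"
  proof (rule sets.empty_continuous_imp_countably_additive)
    show "positive (sets M) (\<lambda>E. ennreal (\<nu> E))"
      unfolding positive_def using null[of "{}"] by simp
    show "additive (sets M) (\<lambda>E. ennreal (\<nu> E))"
      unfolding additive_def using add nonneg by (auto simp: ennreal_plus)
    fix F :: "nat \<Rightarrow> 'a set" assume F: "range F \<subseteq> sets M" "decseq F" "(\<Inter>i. F i) = {}"
    have lim: "(\<lambda>i. measure M (F i)) \<longlonglongrightarrow> 0"
      using finite_Lim_measure_decseq[OF F(1,2)] F(3) by simp
    have "(\<lambda>i. \<nu> (F i)) \<longlonglongrightarrow> 0"
    proof (rule tendstoI)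
      fix e :: real assume "0 < e"
      from ac[OF this] obtain d where "d > 0" and d: "\<forall>E\<in>sets M. measure M E < d \<longrightarrow> \<nu> E < e" by auto
      have "\<forall>\<^sub>F i in sequentially. measure M (F i) < d"
        using order_tendstoD(2)[OF lim \<open>d > 0\<close>] .
      then show "\<forall>\<^sub>F i in sequentially. dist (\<nu> (F i)) 0 < e"
        using F(1) nonneg d by (auto elim!: eventually_mono simp: subset_eq)
    qed
    then show "(\<lambda>i. ennreal (\<nu> (F i))) \<longlonglongrightarrow> 0"
      using tendsto_ennrealI by force
  qed auto
  then have emeasure_N: "emeasure N E = ennreal (\<nu> E)" if "E \<in> sets M" for E
    using that null[of "{}"] unfolding N_def
    by (intro emeasure_measure_of_sigma) (auto simp: positive_def sets.sigma_algebra_axioms)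
  have "finite_measure N"
    by (rule finite_measureI) (simp add: space_N emeasure_N)
  moreover have "absolutely_continuous M N"
    unfolding absolutely_continuous_def null_sets_def
    using null by (auto simp: sets_N emeasure_N measure_def)
  ultimately obtain h where h: "h \<in> borel_measurable M" "AE x in M. RN_deriv M N x = ennreal (h x)"
    "\<And>x. 0 \<le> h x"
    using real_RN_deriv[of N] sets_N by metis
  have eq: "ennreal (\<nu> E) = (\<integral>\<^sup>+x. ennreal (h x * indicator E x) \<partial>M)" if "E \<in> sets M" for E
  proof -
    have "ennreal (\<nu> E) = emeasure (density M (RN_deriv M N)) E"
      using density_RN_deriv[OF \<open>absolutely_continuous M N\<close> sets_N] emeasure_N[OF that] by simp
    also have "\<dots> = (\<integral>\<^sup>+x. RN_deriv M N x * indicator E x \<partial>M)"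
      using that by (intro emeasure_density) auto
    also have "\<dots> = (\<integral>\<^sup>+x. ennreal (h x * indicator E x) \<partial>M)"
      using h(2) by (intro nn_integral_cong_AE) (auto elim!: eventually_mono simp: indicator_def)
    finally show ?thesis .
  qed
  have "integrable M h"
  proof (rule integrableI_nonneg)
    have "(\<integral>\<^sup>+x. ennreal (h x) \<partial>M) = ennreal (\<nu> (space M))"
      unfolding eq[OF sets.top] by (intro nn_integral_cong) simp
    then show "(\<integral>\<^sup>+x. ennreal (h x) \<partial>M) < \<infinity>" by simp
  qed (use h(1,3) in auto)
  moreover have "\<nu> E = (\<integral>x. h x * indicator E x \<partial>M)" if "E \<in> sets M" for E
  proof -
    have "integrable M (\<lambda>x. h x * indicator E x)"
      using \<open>integrable M h\<close> that by (rule integrable_real_mult_indicator[rotated])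
    then have "ennreal (\<nu> E) = ennreal (\<integral>x. h x * indicator E x \<partial>M)"
      unfolding eq[OF that] using h(3) by (intro nn_integral_eq_integral) auto
    then show ?thesis
      using nonneg[OF that] h(3) by (simp add: integral_nonneg)
  qed
  ultimately show ?thesis using h(3) that by blast
qed

text \<open>On indicators, \<open>\<phi>\<close> is a signed set function. Adding
  \<open>L * measure M E\<close> makes it nonnegative and at most
  \<open>2 * L * measure M E\<close>, so a density exists without a Hahn decomposition; subtracting
  L from that density undoes the shift.\<close>

lemma (in finite_measure) L1_dual_representation:
  fixes \<phi> :: "('a \<Rightarrow> real) \<Rightarrow> real"
  assumes add: "\<And>u v. integrable M u \<Longrightarrow> integrable M v \<Longrightarrow> \<phi> (\<lambda>x. u x + v x) = \<phi> u + \<phi> v"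
    and scale: "\<And>r u. integrable M u \<Longrightarrow> \<phi> (\<lambda>x. r * u x) = r * \<phi> u"
    and bound: "\<And>u. integrable M u \<Longrightarrow> \<bar>\<phi> u\<bar> \<le> K * (\<integral>x. \<bar>u x\<bar> \<partial>M)"
  obtains g where "g \<in> borel_measurable M" "\<And>x. \<bar>g x\<bar> \<le> \<bar>K\<bar>"
    "\<And>u. integrable M u \<Longrightarrow> \<phi> u = (\<integral>x. g x * u x \<partial>M)"
proof -
  \<comment> \<open>\<open>K\<close> may be negative; its absolute value can be used as a monotone
    factor.\<close>
  define L where "L = \<bar>K\<bar>"
  have "L \<ge> 0" by (simp add: L_def)
  have bound: "\<bar>\<phi> u\<bar> \<le> L * (\<integral>x. \<bar>u x\<bar> \<partial>M)" if "integrable M u" for u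
    using bound[OF that] by (rule order_trans) (auto simp: L_def intro!: mult_right_mono)
  have ind: "integrable M (indicator E :: 'a \<Rightarrow> real)" if "E \<in> sets M" for E
    using that by (simp add: emeasure_eq_measure)
  have bound_ind: "\<bar>\<phi> (indicator E)\<bar> \<le> L * measure M E" if "E \<in> sets M" for E
    using bound[OF ind[OF that]] that by simp
  define \<nu> where "\<nu> E = \<phi> (indicator E) + L * measure M E" for E
  have \<nu>_le: "\<nu> E \<le> 2 * L * measure M E" and \<nu>_nonneg: "0 \<le> \<nu> E" if "E \<in> sets M" for E
    using bound_ind[OF that] unfolding \<nu>_def by auto
  have \<nu>_add: "\<nu> (E \<union> F) = \<nu> E + \<nu> F" if "E \<in> sets M" "F \<in> sets M" "E \<inter> F = {}" for E F
  proof -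
    have "indicator (E \<union> F) = (\<lambda>x. indicator E x + indicator F x :: real)"
      using that(3) by (auto simp: indicator_def fun_eq_iff)
    then show ?thesis
      unfolding \<nu>_def using add[OF ind ind, OF that(1,2)] finite_measure_Union[OF that]
      by (simp add: algebra_simps)
  qed
  have \<nu>_ac: "\<exists>d>0. \<forall>E\<in>sets M. measure M E < d \<longrightarrow> \<nu> E < e" if "0 < e" for e
  proof (intro exI conjI ballI impI)
    \<comment> \<open>The summand 1 keeps the denominator positive when L = 0.\<close>
    show "0 < e / (2 * L + 1)" using that \<open>L \<ge> 0\<close> by simp
    fix E assume E: "E \<in> sets M" "measure M E < e / (2 * L + 1)"
    have "\<nu> E \<le> (2 * L + 1) * measure M E" 
      using \<nu>_le[OF E(1)] by (simp add: distrib_right add_increasing2)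
    also have "\<dots> < e" using E(2) \<open>L \<ge> 0\<close> by (simp add: pos_less_divide_eq mult.commute)
    finally show "\<nu> E < e" .
  qed
  obtain h where h: "integrable M h" "\<And>x. 0 \<le> h x"
    "\<And>E. E \<in> sets M \<Longrightarrow> \<nu> E = (\<integral>x. h x * indicator E x \<partial>M)"
    using abs_continuous_set_function_density[of \<nu>, OF \<nu>_nonneg \<nu>_add \<nu>_ac] by blast
  have [measurable]: "h \<in> borel_measurable M" using h(1) by auto
  have h_le: "AE x in M. h x \<le> 2 * L"
  proof -
    define E where "E = {x \<in> space M. 2 * L < h x}"
    have [measurable]: "E \<in> sets M" unfolding E_def by measurable
    \<comment> \<open>The excess of h over 2 L has integral
      \<open>\<nu> E - 2 * L * measure M E\<close>, which is at most 0, so the excess vanishes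
      almost everywhere.\<close>
    define k where "k x = (h x - 2 * L) * indicator E x" for x
    have k: "k = (\<lambda>x. h x * indicator E x - 2 * L * indicator E x)"
      by (auto simp: k_def algebra_simps)
    have int: "integrable M (\<lambda>x. h x * indicator E x)"
      using h(1) by (rule integrable_real_mult_indicator[rotated]) simp
    have intk: "integrable M k" unfolding k using int ind[of E] by auto
    have nonneg: "AE x in M. 0 \<le> k x"
      by (auto simp: k_def E_def indicator_def)
    have "integral\<^sup>L M k = \<nu> E - 2 * L * measure M E"
      unfolding k using int ind[of E] by (simp add: h(3))
    then have "integral\<^sup>L M k \<le> 0" using \<nu>_le[of E] by simp
    then have "integral\<^sup>L M k = 0" using integral_nonneg_AE[OF nonneg] by simp
    then have "AE x in M. k x = 0"
      using integral_nonneg_eq_0_iff_AE[OF intk nonneg] by simp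
    with AE_space show ?thesis
      by eventually_elim (auto simp: k_def E_def indicator_def split: if_splits)
  qed
  \<comment> \<open>The truncation alters h only on a null set and makes the bound on g hold
    everywhere.\<close>
  define g where "g x = min (h x) (2 * L) - L" for x
  have g[measurable]: "g \<in> borel_measurable M" unfolding g_def by measurable
  have g_bound: "\<bar>g x\<bar> \<le> L" for x
    using h(2)[of x] \<open>L \<ge> 0\<close> by (auto simp: g_def min_def)
  have gu_int: "integrable M (\<lambda>x. g x * u x)" if "integrable M u" for u
    by (rule Bochner_Integration.integrable_bound[of _ "\<lambda>x. L * u x"])
      (use that g_bound \<open>L \<ge> 0\<close> in \<open>auto simp: abs_mult intro!: mult_right_mono\<close>)
  define \<psi> where "\<psi> u = \<phi> u - (\<integral>x. g x * u x \<partial>M)" for u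
  have \<psi>_add: "\<psi> (\<lambda>x. u x + v x) = \<psi> u + \<psi> v" if "integrable M u" "integrable M v" for u v
    using that gu_int by (simp add: \<psi>_def add distrib_left)
  have \<psi>_scale: "\<psi> (\<lambda>x. r * u x) = r * \<psi> u" if "integrable M u" for r u
    using scale[OF that] by (simp add: \<psi>_def mult.left_commute[of _ r] right_diff_distrib)
  have \<psi>_bound: "\<bar>\<psi> u\<bar> \<le> 2 * L * (\<integral>x. \<bar>u x\<bar> \<partial>M)" if "integrable M u" for u
  proof -
    have "\<bar>\<integral>x. g x * u x \<partial>M\<bar> \<le> (\<integral>x. L * \<bar>u x\<bar> \<partial>M)"
      using that integrable_abs[OF gu_int[OF that]] g_bound
      by (intro order_trans[OF integral_abs_bound] integral_mono)
        (auto simp: abs_mult intro!: mult_right_mono)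
    then show ?thesis using bound[OF that] unfolding \<psi>_def by simp
  qed
  have \<psi>_ind: "\<psi> (indicator E) = 0" if "E \<in> sets M" for E
  proof -
    have "(\<integral>x. g x * indicator E x \<partial>M) = (\<integral>x. h x * indicator E x - L * indicator E x \<partial>M)"
      using h_le that by (intro integral_cong_AE) (auto elim!: eventually_mono simp: g_def indicator_def)
    also have "\<dots> = \<nu> E - L * measure M E"
      using that ind[OF that] h(3)[OF that] integrable_real_mult_indicator[OF that h(1)] by simp
    finally show ?thesis by (simp add: \<psi>_def \<nu>_def)
  qed
  \<comment> \<open>\<open>\<psi>\<close> is linear, L^1-continuous and zero on indicators, so
    density of simple functions suffices.\<close>
  have "\<psi> u = 0" if "integrable M u" for u
    using that
  proof (induction u rule: integrable_induct)
    case (base E r)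
    show ?case
      using \<psi>_scale[OF ind[OF base(1)], of r] \<psi>_ind[OF base(1)] by (simp add: mult.commute)
  next
    case (add u v)
    then show ?case by (simp add: \<psi>_add)
  next
    case (lim f s)
    have conv: "(\<lambda>i. s i x) \<longlonglongrightarrow> f x" if "x \<in> space M" for x
      using lim that by blast
    have dom: "norm (s i x) \<le> 2 * norm (f x)" if "x \<in> space M" for i x
      using lim that by blast
    \<comment> \<open>The difference is written with \<open>(- 1) *\<close> to match the additivity
      and scaling rules of \<open>\<psi>\<close>; it is dominated by |f| + 2 |f|.\<close>
    have intd: "integrable M (\<lambda>x. f x + (- 1) * s i x)" for i
      using lim by auto
    have "(\<lambda>i. \<integral>x. \<bar>f x + (- 1) * s i x\<bar> \<partial>M) \<longlonglongrightarrow> (\<integral>x. 0 \<partial>M)"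
    proof (rule integral_dominated_convergence)
      show "integrable M (\<lambda>x. 3 * \<bar>f x\<bar>)" using lim by auto
      show "AE x in M. (\<lambda>i. \<bar>f x + (- 1) * s i x\<bar>) \<longlonglongrightarrow> 0"
      proof (rule AE_I2)
        fix x assume "x \<in> space M"
        then have "(\<lambda>i. \<bar>f x + (- 1) * s i x\<bar>) \<longlonglongrightarrow> \<bar>f x + (- 1) * f x\<bar>"
          by (intro tendsto_rabs tendsto_add tendsto_mult tendsto_const conv)
        then show "(\<lambda>i. \<bar>f x + (- 1) * s i x\<bar>) \<longlonglongrightarrow> 0" by simp
      qed
      show "AE x in M. norm \<bar>f x + (- 1) * s i x\<bar> \<le> 3 * \<bar>f x\<bar>" for i
        using dom[of _ i] by (intro AE_I2) force
    qed (use intd in auto)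
    then have "(\<lambda>i. 2 * L * (\<integral>x. \<bar>f x + (- 1) * s i x\<bar> \<partial>M)) \<longlonglongrightarrow> 2 * L * 0"
      by (intro tendsto_intros) simp
    moreover have "\<bar>\<psi> f\<bar> \<le> 2 * L * (\<integral>x. \<bar>f x + (- 1) * s i x\<bar> \<partial>M)" for i
    proof -
      have "\<psi> (\<lambda>x. f x + (- 1) * s i x) = \<psi> f + \<psi> (\<lambda>x. (- 1) * s i x)"
        using lim by (intro \<psi>_add) auto
      also have "\<dots> = \<psi> f" using \<psi>_scale[of "s i" "-1"] lim by simp
      finally show ?thesis using \<psi>_bound[OF intd, of i] by simp
    qed
    ultimately have "\<bar>\<psi> f\<bar> \<le> 2 * L * 0"
      by (intro LIMSEQ_le_const) auto
    then show ?case by simp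
  qed
  then show ?thesis
    using that[of g] g g_bound by (auto simp: \<psi>_def L_def)
qed

text \<open>Outer regularity replaces E by an open set, and an open set is an increasing union of
  finite unions of basic open sets. The diagonal argument for weak compactness runs over this
  countable class.\<close>

lemma lebesgue_on_countable_dense_sets:
  fixes \<Omega> :: "'a::euclidean_space set"
  assumes \<Omega>: "\<Omega> \<in> lmeasurable"
  obtains \<A> where "countable \<A>" "\<A> \<subseteq> sets (lebesgue_on \<Omega>)"
    "\<And>E e. E \<in> sets (lebesgue_on \<Omega>) \<Longrightarrow> 0 < e \<Longrightarrow>
       \<exists>F\<in>\<A>. measure (lebesgue_on \<Omega>) ((E - F) \<union> (F - E)) < e"
proof -
  interpret finite_measure "lebesgue_on \<Omega>" by (rule finite_measure_lebesgue_on[OF \<Omega>])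
  have \<Omega>_sets[simp]: "\<Omega> \<in> sets lebesgue" using \<Omega> by auto
  obtain \<B> :: "'a set set" where \<B>: "countable \<B>" "topological_basis \<B>"
    using ex_countable_basis by blast
  have open_\<B>: "open B" if "B \<in> \<B>" for B using topological_basis_open[OF \<B>(2) that] .
  define \<A> where "\<A> = (\<lambda>S. \<Omega> \<inter> \<Union>S) ` {S. S \<subseteq> \<B> \<and> finite S}"
  have set_open: "\<Omega> \<inter> T \<in> sets (lebesgue_on \<Omega>)" if "open T" for T
    using that by (auto simp: sets_restrict_space)
  show ?thesis
  proof
    show "countable \<A>"
      unfolding \<A>_def using countable_Collect_finite_subset[OF \<B>(1)]
      by (intro countable_image) (simp add: conj_commute)
    show "\<A> \<subseteq> sets (lebesgue_on \<Omega>)"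
      unfolding \<A>_def using open_\<B> by (auto intro!: set_open)
  next
    fix E and e :: real assume E: "E \<in> sets (lebesgue_on \<Omega>)" and "0 < e"
    have E_leb: "E \<in> sets lebesgue" and "E \<subseteq> \<Omega>"
      using E by (auto simp: sets_restrict_space)
    obtain T where T: "open T" "E \<subseteq> T" "T - E \<in> lmeasurable" "emeasure lebesgue (T - E) < ennreal (e / 2)"
      using sets_lebesgue_outer_open[OF E_leb, of "e / 2"] \<open>0 < e\<close> by auto
    obtain \<C> where \<C>: "\<C> \<subseteq> \<B>" "T = \<Union>\<C>"
      using \<B>(2) \<open>open T\<close> unfolding topological_basis_def by blast
    obtain S :: "nat \<Rightarrow> 'a set set" where S: "\<And>n. finite (S n)" "\<And>n. S n \<subseteq> \<C>" "incseq S" "(\<Union>n. S n) = \<C>"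
    proof (cases "\<C> = {}")
      case True
      then show ?thesis using that[of "\<lambda>_. {}"] by (auto simp: mono_def)
    next
      case False
      have "countable \<C>" using \<B>(1) \<C>(1) countable_subset by blast
      with False obtain \<sigma> :: "nat \<Rightarrow> 'a set" where range: "range \<sigma> = \<C>"
        by (metis range_from_nat_into)
      show ?thesis
      proof (rule that[of "\<lambda>n. \<sigma> ` {..n}"])
        show "incseq (\<lambda>n. \<sigma> ` {..n})"
          by (intro monoI image_mono) auto
        show "(\<Union>n. \<sigma> ` {..n}) = \<C>"
          using range by auto
        show "\<sigma> ` {..n} \<subseteq> \<C>" for n
          using range by auto
      qed simp
    qed
    have open_S: "open (\<Union>(S n))" for n
      by (intro open_Union ballI open_\<B>) (use S(2) \<C>(1) in blast)
    have "(\<lambda>n. measure (lebesgue_on \<Omega>) (\<Omega> \<inter> \<Union>(S n))) \<longlonglongrightarrow> measure (lebesgue_on \<Omega>) (\<Union>n. \<Omega> \<inter> \<Union>(S n))"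
    proof (rule finite_Lim_measure_incseq)
      show "range (\<lambda>n. \<Omega> \<inter> \<Union>(S n)) \<subseteq> sets (lebesgue_on \<Omega>)"
        using set_open[OF open_S] by auto
      show "incseq (\<lambda>n. \<Omega> \<inter> \<Union>(S n))"
        using S(3) unfolding mono_def by blast
    qed
    moreover have "(\<Union>n. \<Omega> \<inter> \<Union>(S n)) = \<Omega> \<inter> T" using S(4) \<C>(2) by auto
    ultimately have "(\<lambda>n. measure (lebesgue_on \<Omega>) (\<Omega> \<inter> \<Union>(S n))) \<longlonglongrightarrow> measure (lebesgue_on \<Omega>) (\<Omega> \<inter> T)"
      by simp
    then have "\<forall>\<^sub>F n in sequentially. measure (lebesgue_on \<Omega>) (\<Omega> \<inter> T) - e / 2 < measure (lebesgue_on \<Omega>) (\<Omega> \<inter> \<Union>(S n))"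
      using \<open>0 < e\<close> by (intro order_tendstoD(1)) auto
    then obtain n where n: "measure (lebesgue_on \<Omega>) (\<Omega> \<inter> T) - e / 2 < measure (lebesgue_on \<Omega>) (\<Omega> \<inter> \<Union>(S n))"
      using eventually_happens by fastforce
    define F where "F = \<Omega> \<inter> \<Union>(S n)"
    have F: "F \<in> \<A>" "F \<subseteq> \<Omega> \<inter> T" using S(1,2)[of n] \<C> unfolding \<A>_def F_def by auto
    have sF: "F \<in> sets (lebesgue_on \<Omega>)"
      unfolding F_def by (rule set_open[OF open_S])
    have sT: "\<Omega> \<inter> T \<in> sets (lebesgue_on \<Omega>)" using T(1) by (rule set_open)
    \<comment> \<open>Both E and F lie in \<open>\<Omega> \<inter> T\<close>, so the two differences
      are bounded by its complements of F and of E, each of measure below e / 2.\<close>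
    have "measure (lebesgue_on \<Omega>) ((E - F) \<union> (F - E)) \<le>
        measure (lebesgue_on \<Omega>) ((\<Omega> \<inter> T - F) \<union> (\<Omega> \<inter> T - E))"
      using E sF sT F(2) \<open>E \<subseteq> \<Omega>\<close> T(2) by (intro finite_measure_mono) auto
    also have "\<dots> \<le> measure (lebesgue_on \<Omega>) (\<Omega> \<inter> T - F) + measure (lebesgue_on \<Omega>) (\<Omega> \<inter> T - E)"
      using E sF sT by (intro measure_Un_le) auto
    also have "measure (lebesgue_on \<Omega>) (\<Omega> \<inter> T - F) < e / 2"
      using n finite_measure_Diff[OF sT sF F(2)] by (simp add: F_def)
    also have "measure (lebesgue_on \<Omega>) (\<Omega> \<inter> T - E) < e / 2"
    proof -
      have "measure (lebesgue_on \<Omega>) (\<Omega> \<inter> T - E) = measure lebesgue (\<Omega> \<inter> T - E)"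
        by (intro measure_restrict_space) auto
      also have "\<dots> \<le> measure lebesgue (T - E)"
        using T(3) E_leb T(1) by (intro measure_mono_fmeasurable sets.Diff sets.Int) auto
      also have "\<dots> < e / 2"
        using T(3,4) \<open>0 < e\<close> by (simp add: emeasure_eq_measure2 ennreal_less_iff)
      finally show ?thesis .
    qed
    finally show "\<exists>F\<in>\<A>. measure (lebesgue_on \<Omega>) ((E - F) \<union> (F - E)) < e"
      using F(1) by auto
  qed
qed

lemma integrable_bounded_mult:
  fixes f u :: "'a \<Rightarrow> real"
  assumes "integrable M u" "f \<in> borel_measurable M" "AE x in M. \<bar>f x\<bar> \<le> C"
  shows "integrable M (\<lambda>x. f x * u x)"
proof (rule Bochner_Integration.integrable_bound[of _ "\<lambda>x. C * u x"])
  show "AE x in M. norm (f x * u x) \<le> norm (C * u x)"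
    using assms(3)
  proof eventually_elim
    case (elim x)
    then have "\<bar>f x\<bar> * \<bar>u x\<bar> \<le> \<bar>C\<bar> * \<bar>u x\<bar>" by (intro mult_right_mono) auto
    then show ?case by (simp add: abs_mult)
  qed
qed (use assms in auto)

text \<open>The compactness half of the Dunford-Pettis theorem for nonnegative functions. Uniform
  integrability spreads convergence from the dense class to all measurable sets, and the setwise
  limit inherits the uniform modulus directly, hence has a density; no Vitali-Hahn-Saks argument
  enters.\<close>

lemma (in finite_measure) L1_weakly_compact:
  fixes u :: "nat \<Rightarrow> 'a \<Rightarrow> real"
  assumes dense: "countable \<A>" "\<A> \<subseteq> sets M"
      "\<And>E e. E \<in> sets M \<Longrightarrow> 0 < e \<Longrightarrow> \<exists>F\<in>\<A>. measure M ((E - F) \<union> (F - E)) < e"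
    and int: "\<And>n. integrable M (u n)"
    and nonneg: "\<And>n. AE x in M. 0 \<le> u n x"
    and bounded: "\<And>n. (\<integral>x. u n x \<partial>M) \<le> B"
    and unif: "\<And>e. 0 < e \<Longrightarrow>
      \<exists>d>0. \<forall>n. \<forall>E\<in>sets M. measure M E < d \<longrightarrow> (\<integral>x. u n x * indicator E x \<partial>M) < e"
  obtains r v where "strict_mono (r :: nat \<Rightarrow> nat)" "integrable M v"
    "\<And>g C. g \<in> borel_measurable M \<Longrightarrow> (\<And>x. \<bar>g x\<bar> \<le> C) \<Longrightarrow>
       (\<lambda>n. \<integral>x. g x * u (r n) x \<partial>M) \<longlonglongrightarrow> (\<integral>x. g x * v x \<partial>M)"
proof -
  define q where "q n E = (\<integral>x. u n x * indicator E x \<partial>M)" for n E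
  have int_ind: "integrable M (\<lambda>x. u n x * indicator E x)" if "E \<in> sets M" for n E
    using that int by (intro integrable_real_mult_indicator)
  have q_nonneg: "0 \<le> q n E" for n E
    unfolding q_def using nonneg[of n]
    by (intro integral_nonneg_AE) (auto elim!: eventually_mono)
  have q_mono: "q n E \<le> q n F" if "E \<subseteq> F" "E \<in> sets M" "F \<in> sets M" for n E F
    unfolding q_def using nonneg[of n] that int_ind
    by (intro integral_mono_AE) (auto elim!: eventually_mono simp: indicator_def)
  have q_Un: "q n (E \<union> F) = q n E + q n F" if "E \<in> sets M" "F \<in> sets M" "E \<inter> F = {}" for n E F
  proof -
    have "q n (E \<union> F) = (\<integral>x. u n x * indicator E x + u n x * indicator F x \<partial>M)"
      unfolding q_def using that(3) by (intro Bochner_Integration.integral_cong) (auto simp: indicator_def)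
    then show ?thesis using that int_ind unfolding q_def by simp
  qed
  have q_top: "q n (space M) \<le> B" for n
    using bounded[of n] unfolding q_def by (simp cong: Bochner_Integration.integral_cong)
  have q_le: "q n E \<le> B" if "E \<in> sets M" for n E
    using q_mono[OF sets.sets_into_space[OF that] that sets.top] q_top order_trans by blast
  have q_diff: "\<bar>q n E - q n F\<bar> \<le> q n ((E - F) \<union> (F - E))" if [measurable]: "E \<in> sets M" "F \<in> sets M" for n E F
  proof -
    have "q n X = q n (X \<inter> Y) + q n (X - Y)" if "X \<in> sets M" "Y \<in> sets M" for X Y
      using q_Un[of "X \<inter> Y" "X - Y" n] that by (simp add: Int_Diff_Un Int_Diff Diff_Int_distrib)
    from this[of E F] this[of F E]
    have "q n E = q n (E \<inter> F) + q n (E - F)" "q n F = q n (E \<inter> F) + q n (F - E)"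
      by (simp_all add: Int_commute)
    moreover have "q n ((E - F) \<union> (F - E)) = q n (E - F) + q n (F - E)"
      using that by (intro q_Un) auto
    ultimately show ?thesis using q_nonneg[of n "E - F"] q_nonneg[of n "F - E"] by linarith
  qed
  have "norm (q n E) \<le> B" if "E \<in> \<A>" for n E
    using q_le[of E n] q_nonneg[of n E] that dense(2) by auto
  \<comment> \<open>Cantor's diagonal argument; \<open>function_convergent_subsequence\<close> comes
    from the imported complex analysis library.\<close>
  then obtain r where r: "strict_mono (r :: nat \<Rightarrow> nat)"
    and conv_\<A>: "\<And>E. E \<in> \<A> \<Longrightarrow> convergent (\<lambda>n. q (r n) E)"
    using function_convergent_subsequence[OF dense(1), of q B] unfolding convergent_def by metis
  have "Cauchy (\<lambda>n. q (r n) E)" if E: "E \<in> sets M" for E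
  proof (rule metric_CauchyI)
    fix e :: real assume "0 < e"
    then obtain d where d: "d > 0"
      "\<And>n E. E \<in> sets M \<Longrightarrow> measure M E < d \<Longrightarrow> q n E < e / 3"
      using unif[of "e / 3"] unfolding q_def by auto
    obtain F where F: "F \<in> \<A>" "measure M ((E - F) \<union> (F - E)) < d"
      using dense(3)[OF E d(1)] by blast
    have F_sets: "F \<in> sets M" using F(1) dense(2) by auto
    have close: "\<bar>q n E - q n F\<bar> < e / 3" for n
      using q_diff[OF E F_sets, of n] d(2)[OF _ F(2), of n] E F_sets by force
    obtain N where N: "\<And>i j. i \<ge> N \<Longrightarrow> j \<ge> N \<Longrightarrow> dist (q (r i) F) (q (r j) F) < e / 3"
      using metric_CauchyD[OF convergent_Cauchy[OF conv_\<A>[OF F(1)]], of "e / 3"] \<open>0 < e\<close> by auto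
    have "dist (q (r i) E) (q (r j) E) < e" if "i \<ge> N" "j \<ge> N" for i j
      using close[of "r i"] close[of "r j"] N[OF that] unfolding dist_real_def by linarith
    then show "\<exists>N. \<forall>i\<ge>N. \<forall>j\<ge>N. dist (q (r i) E) (q (r j) E) < e" by blast
  qed
  then have "convergent (\<lambda>n. q (r n) E)" if "E \<in> sets M" for E
    using that Cauchy_convergent by blast
  then obtain \<nu> where \<nu>: "\<And>E. E \<in> sets M \<Longrightarrow> (\<lambda>n. q (r n) E) \<longlonglongrightarrow> \<nu> E"
    unfolding convergent_def by metis
  have \<nu>_nonneg: "0 \<le> \<nu> E" if "E \<in> sets M" for E
    using LIMSEQ_le_const[OF \<nu>[OF that]] q_nonneg by blast
  have \<nu>_add: "\<nu> (E \<union> F) = \<nu> E + \<nu> F" if "E \<in> sets M" "F \<in> sets M" "E \<inter> F = {}" for E F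
  proof (rule LIMSEQ_unique)
    show "(\<lambda>n. q (r n) (E \<union> F)) \<longlonglongrightarrow> \<nu> (E \<union> F)" using that by (intro \<nu>) auto
    show "(\<lambda>n. q (r n) (E \<union> F)) \<longlonglongrightarrow> \<nu> E + \<nu> F"
      unfolding q_Un[OF that] using that by (intro tendsto_add \<nu>) auto
  qed
  have \<nu>_ac: "\<exists>d>0. \<forall>E\<in>sets M. measure M E < d \<longrightarrow> \<nu> E < e" if "0 < e" for e
  proof -
    obtain d where d: "d > 0" "\<And>n E. E \<in> sets M \<Longrightarrow> measure M E < d \<Longrightarrow> q n E < e / 2"
      using unif[of "e / 2"] \<open>0 < e\<close> unfolding q_def by auto
    have "\<nu> E < e" if E: "E \<in> sets M" "measure M E < d" for E
    proof -
      have "\<nu> E \<le> e / 2"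
        using LIMSEQ_le_const2[OF \<nu>[OF E(1)]] d(2)[OF E] less_imp_le by blast
      then show ?thesis using \<open>0 < e\<close> by linarith
    qed
    then show ?thesis using d(1) by blast
  qed
  obtain v where v: "integrable M v" "\<And>x. 0 \<le> v x"
    "\<And>E. E \<in> sets M \<Longrightarrow> \<nu> E = (\<integral>x. v x * indicator E x \<partial>M)"
    using abs_continuous_set_function_density[of \<nu>, OF \<nu>_nonneg \<nu>_add \<nu>_ac] by blast
  have v_top: "(\<integral>x. v x \<partial>M) \<le> B"
  proof -
    have "\<nu> (space M) \<le> B"
      using LIMSEQ_le_const2[OF \<nu>[OF sets.top]] q_top by blast
    then show ?thesis using v(3)[OF sets.top] by (simp cong: Bochner_Integration.integral_cong)
  qed
  have "B \<ge> 0" using q_top[of 0] q_nonneg[of 0 "space M"] by linarith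
  show ?thesis
  proof (rule that[OF r v(1)])
    fix g :: "'a \<Rightarrow> real" and C :: real
    assume g[measurable]: "g \<in> borel_measurable M" and C: "\<And>x. \<bar>g x\<bar> \<le> C"
    show "(\<lambda>n. \<integral>x. g x * u (r n) x \<partial>M) \<longlonglongrightarrow> (\<integral>x. g x * v x \<partial>M)"
    proof (rule tendstoI)
      fix e :: real assume "0 < e"
      \<comment> \<open>Rounding g down to multiples of 1 / N changes each integral by at most B / N
        < e / 3; B + 1 keeps N positive when B = 0.\<close>
      define N where "N = 3 * (B + 1) / e"
      have "N > 0" using \<open>B \<ge> 0\<close> \<open>0 < e\<close> by (simp add: N_def)
      define s where "s x = real_of_int \<lfloor>N * g x\<rfloor> / N" for x
      have s_meas[measurable]: "s \<in> borel_measurable M" unfolding s_def by measurable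
      have gs: "\<bar>g x - s x\<bar> \<le> 1 / N" for x
      proof -
        have "\<bar>N * g x - \<lfloor>N * g x\<rfloor>\<bar> \<le> 1" by linarith
        moreover have "g x - s x = (N * g x - \<lfloor>N * g x\<rfloor>) / N"
          using \<open>N > 0\<close> by (simp add: s_def diff_divide_distrib)
        ultimately show ?thesis using \<open>N > 0\<close> by (simp add: divide_right_mono)
      qed
      have s_bound: "\<bar>s x\<bar> \<le> C + 1 / N" for x
        using gs[of x] C[of x] by linarith
      \<comment> \<open>Since g is bounded, the rounded function has finitely many values, so its
        integrals are finite combinations of the setwise integrals whose limits are known.\<close>
      define R where "R = (\<lambda>k. real_of_int k / N) ` {\<lfloor>- (N * C)\<rfloor>..\<lfloor>N * C\<rfloor>}"
      have "finite R" unfolding R_def by simp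
      have s_R: "s x \<in> R" for x
      proof -
        have "- (N * C) \<le> N * g x" "N * g x \<le> N * C"
          using C[of x] \<open>N > 0\<close> mult_left_mono[of "- C" "g x" N] by (auto simp: abs_le_iff)
        then show ?thesis unfolding s_def R_def by (intro imageI) (auto intro: floor_mono)
      qed
      define L where "L a = s -` {a} \<inter> space M" for a
      have L[measurable]: "L a \<in> sets M" for a unfolding L_def by measurable
      have s_int: "(\<integral>x. s x * w x \<partial>M) = (\<Sum>a\<in>R. a * (\<integral>x. w x * indicator (L a) x \<partial>M))"
        if w: "integrable M w" for w :: "'a \<Rightarrow> real"
      proof -
        have "(\<integral>x. s x * w x \<partial>M) = (\<integral>x. (\<Sum>a\<in>R. a * (w x * indicator (L a) x)) \<partial>M)"
        proof (rule Bochner_Integration.integral_cong[OF refl])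
          fix x assume "x \<in> space M"
          then have "(\<Sum>a\<in>R. a * (w x * indicator (L a) x)) = (\<Sum>a\<in>R. if s x = a then a * w x else 0)"
            by (intro sum.cong) (auto simp: L_def indicator_def)
          then show "s x * w x = (\<Sum>a\<in>R. a * (w x * indicator (L a) x))"
            using \<open>finite R\<close> s_R[of x] by simp
        qed
        also have "\<dots> = (\<Sum>a\<in>R. \<integral>x. a * (w x * indicator (L a) x) \<partial>M)"
          by (intro Bochner_Integration.integral_sum integrable_mult_right integrable_real_mult_indicator w L)
        finally show ?thesis by simp
      qed
      have lim: "(\<lambda>n. \<integral>x. s x * u (r n) x \<partial>M) \<longlonglongrightarrow> (\<integral>x. s x * v x \<partial>M)"
        unfolding s_int[OF int] s_int[OF v(1)] v(3)[OF L, symmetric] q_def[symmetric]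
        by (intro tendsto_sum tendsto_mult tendsto_const \<nu> L)
      \<comment> \<open>Used for \<open>u (r n)\<close> and for the limit \<open>v\<close>, which is
        why the mass bound \<open>v_top\<close> was carried over.\<close>
      have err: "\<bar>(\<integral>x. g x * w x \<partial>M) - (\<integral>x. s x * w x \<partial>M)\<bar> < e / 3"
        if w: "integrable M w" "AE x in M. 0 \<le> w x" "(\<integral>x. w x \<partial>M) \<le> B" for w
      proof -
        have gw: "integrable M (\<lambda>x. g x * w x)" using C by (intro integrable_bounded_mult[OF w(1) g]) auto
        have sw: "integrable M (\<lambda>x. s x * w x)" using s_bound by (intro integrable_bounded_mult[OF w(1) s_meas]) auto
        have "\<bar>(\<integral>x. g x * w x \<partial>M) - (\<integral>x. s x * w x \<partial>M)\<bar> = \<bar>\<integral>x. g x * w x - s x * w x \<partial>M\<bar>"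
          using gw sw by simp
        also have "\<dots> \<le> (\<integral>x. \<bar>g x * w x - s x * w x\<bar> \<partial>M)" by (rule integral_abs_bound)
        also have "\<dots> \<le> (\<integral>x. 1 / N * w x \<partial>M)"
        proof (rule integral_mono_AE)
          show "AE x in M. \<bar>g x * w x - s x * w x\<bar> \<le> 1 / N * w x"
            using w(2)
          proof eventually_elim
            case (elim x)
            have "\<bar>g x * w x - s x * w x\<bar> = \<bar>g x - s x\<bar> * w x"
              using elim by (simp add: abs_mult flip: left_diff_distrib)
            then show ?case using gs[of x] elim by (simp only: mult_right_mono)
          qed
        qed (use gw sw w(1) in auto)
        also have "\<dots> = 1 / N * (\<integral>x. w x \<partial>M)" by simp
        also have "\<dots> \<le> 1 / N * B" using w(3) \<open>N > 0\<close> by (intro mult_left_mono) auto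
        also have "\<dots> < e / 3" using \<open>0 < e\<close> \<open>B \<ge> 0\<close> by (simp add: N_def field_simps)
        finally show ?thesis .
      qed
      have "\<forall>\<^sub>F n in sequentially. dist (\<integral>x. s x * u (r n) x \<partial>M) (\<integral>x. s x * v x \<partial>M) < e / 3"
        using tendstoD[OF lim, of "e / 3"] \<open>0 < e\<close> by simp
      then show "\<forall>\<^sub>F n in sequentially. dist (\<integral>x. g x * u (r n) x \<partial>M) (\<integral>x. g x * v x \<partial>M) < e"
      proof eventually_elim
        case (elim n)
        then show ?case
          using err[OF int nonneg bounded, of "r n"] err[OF v(1) AE_I2[OF v(2)] v_top]
          unfolding dist_real_def by linarith
      qed
    qed
  qed
qed

subsection \<open>Entropy and Kullback-Leibler divergence\<close>

lemma bounded_linear_L1_representation: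
  fixes \<phi> :: "('a::euclidean_space \<Rightarrow> real) \<Rightarrow> real"
  assumes \<Omega>: "\<Omega> \<in> lmeasurable" and \<phi>: "bounded_linear_L1 \<Omega> \<phi>"
  obtains g C where "g \<in> borel_measurable (lebesgue_on \<Omega>)" "\<And>x. \<bar>g x\<bar> \<le> C"
    "\<And>u. u \<in> L1 \<Omega> \<Longrightarrow> \<phi> u = (\<integral>t. g t * u t \<partial>lebesgue_on \<Omega>)"
proof -
  interpret finite_measure "lebesgue_on \<Omega>" by (rule finite_measure_lebesgue_on[OF \<Omega>])
  obtain K where K: "\<And>u. u \<in> L1 \<Omega> \<Longrightarrow> norm (\<phi> u) \<le> K * (\<integral>t. \<bar>u t\<bar> \<partial>lebesgue_on \<Omega>)"
    using \<phi> unfolding bounded_linear_L1_def by blast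
  obtain g where "g \<in> borel_measurable (lebesgue_on \<Omega>)" "\<And>x. \<bar>g x\<bar> \<le> \<bar>K\<bar>"
    "\<And>u. integrable (lebesgue_on \<Omega>) u \<Longrightarrow> \<phi> u = (\<integral>t. g t * u t \<partial>lebesgue_on \<Omega>)"
    by (rule L1_dual_representation[of \<phi> K]) (use \<phi> K in \<open>auto simp: bounded_linear_L1_def L1_def\<close>)
  then show ?thesis using that by (auto simp: L1_def)
qed

lemma bounded_linear_L1_inner:
  assumes A: "bounded_linear_L1 \<Omega> A"
  shows "bounded_linear_L1 \<Omega> (\<lambda>u. w \<bullet> A u)"
  unfolding bounded_linear_L1_def
proof (intro conjI)
  obtain K where K: "\<And>u. u \<in> L1 \<Omega> \<Longrightarrow> norm (A u) \<le> K * (\<integral>t. \<bar>u t\<bar> \<partial>lebesgue_on \<Omega>)"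
    using A unfolding bounded_linear_L1_def by blast
  show "\<exists>K. \<forall>u\<in>L1 \<Omega>. norm (w \<bullet> A u) \<le> K * (\<integral>t. \<bar>u t\<bar> \<partial>lebesgue_on \<Omega>)"
  proof (intro exI ballI)
    fix u assume "u \<in> L1 \<Omega>"
    have "norm (w \<bullet> A u) \<le> norm w * norm (A u)" using Cauchy_Schwarz_ineq2[of w "A u"] by simp
    also have "\<dots> \<le> norm w * (K * (\<integral>t. \<bar>u t\<bar> \<partial>lebesgue_on \<Omega>))"
      using K[OF \<open>u \<in> L1 \<Omega>\<close>] by (intro mult_left_mono) auto
    finally show "norm (w \<bullet> A u) \<le> (norm w * K) * (\<integral>t. \<bar>u t\<bar> \<partial>lebesgue_on \<Omega>)"
      by (simp add: mult.assoc)
  qed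
qed (use A in \<open>auto simp: bounded_linear_L1_def inner_add_right\<close>)

lemma bounded_linear_L1_cong_AE:
  assumes A: "bounded_linear_L1 \<Omega> A" and u: "u \<in> L1 \<Omega>" and v: "v \<in> L1 \<Omega>"
    and eq: "AE t in lebesgue_on \<Omega>. u t = v t"
  shows "A u = A v"
proof -
  obtain K where K: "\<And>u. u \<in> L1 \<Omega> \<Longrightarrow> norm (A u) \<le> K * (\<integral>t. \<bar>u t\<bar> \<partial>lebesgue_on \<Omega>)"
    using A unfolding bounded_linear_L1_def by blast
  have v': "(\<lambda>t. -1 * v t) \<in> L1 \<Omega>" using v by (simp add: L1_def)
  have "A (\<lambda>t. u t + -1 * v t) = A u - A v"
    using A u v v' unfolding bounded_linear_L1_def by (metis scaleR_minus1_left uminus_add_conv_diff add.commute)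
  moreover have "(\<integral>t. \<bar>u t + -1 * v t\<bar> \<partial>lebesgue_on \<Omega>) = 0"
    using eq by (intro integral_eq_zero_AE) (auto elim!: eventually_mono)
  moreover have "(\<lambda>t. u t + -1 * v t) \<in> L1 \<Omega>" using u v by (simp add: L1_def)
  ultimately show ?thesis using K[of "\<lambda>t. u t + -1 * v t"] by simp
qed

section \<open>The domains of f and of its subdifferential\<close>

lemma dom_fD:
  assumes "v \<in> dom_f \<Omega>"
  shows "integrable (lebesgue_on \<Omega>) v" "v \<in> L1 \<Omega>" "AE t in lebesgue_on \<Omega>. 0 \<le> v t"
    "integrable (lebesgue_on \<Omega>) (\<lambda>t. v t * ln (v t))"
    "neg_entropy \<Omega> v = ereal (\<integral>t. v t * ln (v t) \<partial>lebesgue_on \<Omega>)"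
  using assms by (auto simp: dom_f_def L1_def neg_entropy_def split: if_splits)

lemma dom_subdiff_f_ln:
  assumes "w \<in> dom_subdiff_f \<Omega>"
  shows "\<exists>C. AE t in lebesgue_on \<Omega>. \<bar>ln (w t)\<bar> \<le> C"
    and "(\<lambda>t. ln (w t)) \<in> borel_measurable (lebesgue_on \<Omega>)"
proof -
  obtain a b where ab: "0 < a" "AE t in lebesgue_on \<Omega>. a \<le> w t \<and> w t \<le> b"
    and w: "w \<in> borel_measurable (lebesgue_on \<Omega>)"
    using assms by (auto simp: dom_subdiff_f_def L1_def)
  show "\<exists>C. AE t in lebesgue_on \<Omega>. \<bar>ln (w t)\<bar> \<le> C"
  proof
    show "AE t in lebesgue_on \<Omega>. \<bar>ln (w t)\<bar> \<le> \<bar>ln a\<bar> + \<bar>ln b\<bar>"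
      using ab(2)
    proof eventually_elim
      case (elim t)
      then have "ln a \<le> ln (w t)" "ln (w t) \<le> ln b" using ab(1) by auto
      then show ?case by linarith
    qed
  qed
  show "(\<lambda>t. ln (w t)) \<in> borel_measurable (lebesgue_on \<Omega>)" using w by measurable
qed

lemma dom_subdiff_f_integrable_ln:
  assumes "w \<in> dom_subdiff_f \<Omega>" "v \<in> L1 \<Omega>"
  shows "integrable (lebesgue_on \<Omega>) (\<lambda>t. v t * ln (w t))"
proof -
  obtain C where "AE t in lebesgue_on \<Omega>. \<bar>ln (w t)\<bar> \<le> C" using dom_subdiff_f_ln(1)[OF assms(1)] by blast
  from integrable_bounded_mult[OF _ dom_subdiff_f_ln(2)[OF assms(1)] this, of v] assms(2)
  show ?thesis by (simp add: L1_def mult.commute)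
qed

lemma dom_subdiff_f_subset: "w \<in> dom_subdiff_f \<Omega> \<Longrightarrow> w \<in> dom_f \<Omega>"
proof -
  assume w: "w \<in> dom_subdiff_f \<Omega>"
  then have "w \<in> L1 \<Omega>" by (simp add: dom_subdiff_f_def)
  moreover have "AE t in lebesgue_on \<Omega>. 0 \<le> w t"
    using w by (auto simp: dom_subdiff_f_def elim!: eventually_mono)
  ultimately show ?thesis
    using dom_subdiff_f_integrable_ln[OF w] by (simp add: dom_f_def neg_entropy_def)
qed

lemma dom_subdiff_fI:
  assumes "u \<in> L1 \<Omega>" "0 < a" "AE t in lebesgue_on \<Omega>. a \<le> u t \<and> u t \<le> b"
  shows "u \<in> dom_subdiff_f \<Omega>"
  using assms by (auto simp only: dom_subdiff_f_def)

lemma dom_subdiff_fD: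
  assumes "w \<in> dom_subdiff_f \<Omega>"
  shows "w \<in> L1 \<Omega>" "integrable (lebesgue_on \<Omega>) w" "AE t in lebesgue_on \<Omega>. 0 < w t"
  using assms by (auto simp: dom_subdiff_f_def L1_def elim!: eventually_mono)

section \<open>The Kullback-Leibler divergence and the minimization step\<close>

text \<open>Pulling out v leaves (w / v - 1) - ln (w / v), so everything rests on ln x <= x - 1 with
  equality only at x = 1. Keeping \<open>ln v\<close> and \<open>ln w\<close> apart prepares for
  termwise integration.\<close>

lemma kl_pointwise:
  fixes v w :: real
  assumes "0 \<le> v" "0 < w"
  shows "0 \<le> v * ln v - v * ln w - v + w"
    and "v * ln v - v * ln w - v + w = 0 \<longleftrightarrow> v = w"
    and "kl_integrand v w = ennreal (v * ln v - v * ln w - v + w)"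
proof -
  have "0 \<le> v * ln v - v * ln w - v + w \<and> (v * ln v - v * ln w - v + w = 0 \<longleftrightarrow> v = w) \<and>
      v * ln (v / w) = v * ln v - v * ln w"
  proof (cases "v = 0")
    case False
    then have "v > 0" using assms by simp
    have eq: "v * ln v - v * ln w - v + w = v * ((w / v - 1) - ln (w / v))"
      using \<open>v > 0\<close> assms by (simp add: ln_div field_simps)
    have "ln (w / v) \<le> w / v - 1" using \<open>v > 0\<close> assms by (intro ln_le_minus_one) auto
    moreover have "ln (w / v) = w / v - 1 \<longleftrightarrow> w / v = 1"
      using ln_eq_minus_one[of "w / v"] \<open>v > 0\<close> assms by auto
    moreover have "v * ln (v / w) = v * ln v - v * ln w"
      using \<open>v > 0\<close> assms by (simp add: ln_div right_diff_distrib)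
    ultimately show ?thesis unfolding eq using \<open>v > 0\<close> by auto
  qed (use assms in auto)
  then show "0 \<le> v * ln v - v * ln w - v + w" "v * ln v - v * ln w - v + w = 0 \<longleftrightarrow> v = w"
    "kl_integrand v w = ennreal (v * ln v - v * ln w - v + w)"
    using assms by (auto simp: kl_integrand_def)
qed

text \<open>A real-valued divergence split into four integrals, so that identities between
  divergences become linear arithmetic. It is meaningful for v in \<open>dom_f\<close> and w in
  \<open>dom_subdiff_f\<close>, where all four exist; elsewhere a non-integrable term counts as
  0.\<close>

definition kl :: "'a::euclidean_space set \<Rightarrow> ('a \<Rightarrow> real) \<Rightarrow> ('a \<Rightarrow> real) \<Rightarrow> real" where
  "kl \<Omega> v w = (\<integral>t. v t * ln (v t) \<partial>lebesgue_on \<Omega>) - (\<integral>t. v t * ln (w t) \<partial>lebesgue_on \<Omega>)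
     - (\<integral>t. v t \<partial>lebesgue_on \<Omega>) + (\<integral>t. w t \<partial>lebesgue_on \<Omega>)"

lemma kl_self [simp]: "kl \<Omega> v v = 0"
  by (simp add: kl_def)

text \<open>Boundedness of ln w makes every term integrable, so the pointwise facts integrate. The
  last claim makes minimizers unique up to null sets.\<close>

lemma
  assumes v: "v \<in> dom_f \<Omega>" and w: "w \<in> dom_subdiff_f \<Omega>"
  shows kl_nonneg: "0 \<le> kl \<Omega> v w"
    and KL_eq_kl: "KL \<Omega> v w = ennreal (kl \<Omega> v w)"
    and kl_eq_0D: "kl \<Omega> v w = 0 \<Longrightarrow> AE t in lebesgue_on \<Omega>. v t = w t"
proof -
  let ?M = "lebesgue_on \<Omega>"
  define k where "k t = v t * ln (v t) - v t * ln (w t) - v t + w t" for t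
  note int = dom_fD(1,4)[OF v] dom_subdiff_f_integrable_ln[OF w dom_fD(2)[OF v]] dom_subdiff_fD(2)[OF w]
  have int_k: "integrable ?M k" unfolding k_def using int by auto
  have kl: "kl \<Omega> v w = integral\<^sup>L ?M k" unfolding k_def kl_def using int by simp
  have pos: "AE t in ?M. 0 \<le> v t \<and> 0 < w t"
    using dom_fD(3)[OF v] dom_subdiff_fD(3)[OF w] by eventually_elim simp
  then have nonneg: "AE t in ?M. 0 \<le> k t"
    by eventually_elim (auto simp: k_def intro: kl_pointwise)
  then show "0 \<le> kl \<Omega> v w" unfolding kl by (rule integral_nonneg_AE)
  have "KL \<Omega> v w = (\<integral>\<^sup>+t. ennreal (k t) \<partial>?M)"
    unfolding KL_def using pos
    by (intro nn_integral_cong_AE, eventually_elim) (simp add: k_def kl_pointwise)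
  then show "KL \<Omega> v w = ennreal (kl \<Omega> v w)"
    unfolding kl using nn_integral_eq_integral[OF int_k nonneg] by simp
  assume "kl \<Omega> v w = 0"
  then have "AE t in ?M. k t = 0"
    unfolding kl using integral_nonneg_eq_0_iff_AE[OF int_k nonneg] by simp
  with pos show "AE t in ?M. v t = w t"
    by eventually_elim (simp add: k_def kl_pointwise)
qed

text \<open>
  With \<open>p = u e^(A* r / c + \<beta>)\<close> the step objective equals \<open>c d(v, p)\<close> up to a constant on the feasible
  set, so that \<open>p\<close> is its unique minimizer.
\<close>

lemma step_minimizer:
  fixes A :: "('a::euclidean_space \<Rightarrow> real) \<Rightarrow> 'y::real_inner"
  assumes \<Omega>: "\<Omega> \<in> lmeasurable" and m: "m \<in> {0, 1}" and c: "c > 0" and A: "bounded_linear_L1 \<Omega> A"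
    and u: "u \<in> dom_subdiff_f \<Omega>" and u_norm: "m = 1 \<Longrightarrow> (\<integral>t. u t \<partial>lebesgue_on \<Omega>) = 1"
    and v: "is_arg_min (step_objective \<Omega> A m c yd u) (\<lambda>v. v \<in> dom_f \<Omega>) v"
  obtains \<beta> where "v \<in> dom_subdiff_f \<Omega>" "m = 1 \<Longrightarrow> (\<integral>t. v t \<partial>lebesgue_on \<Omega>) = 1" "m = 0 \<Longrightarrow> \<beta> = 0"
    "\<And>w. w \<in> L1 \<Omega> \<Longrightarrow> (\<integral>t. w t * ln (v t) \<partial>lebesgue_on \<Omega>) =
       (\<integral>t. w t * ln (u t) \<partial>lebesgue_on \<Omega>) + (yd - A u) \<bullet> A w / c + \<beta> * (\<integral>t. w t \<partial>lebesgue_on \<Omega>)"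
proof -
  let ?M = "lebesgue_on \<Omega>"
  interpret finite_measure ?M by (rule finite_measure_lebesgue_on[OF \<Omega>])
  define r where "r = yd - A u"
  obtain g C where g[measurable]: "g \<in> borel_measurable ?M" and C: "\<And>x. \<bar>g x\<bar> \<le> C"
    and gA: "\<And>u. u \<in> L1 \<Omega> \<Longrightarrow> r \<bullet> A u = (\<integral>t. g t * u t \<partial>?M)"
    using bounded_linear_L1_representation[OF \<Omega> bounded_linear_L1_inner[OF A, of r]] by blast
  have gc: "- (C / c) \<le> g t / c" "g t / c \<le> C / c" for t
    using C[of t] c by (auto simp: field_simps abs_le_iff)
  obtain a b where ab: "0 < a" "AE t in ?M. a \<le> u t \<and> u t \<le> b"
    using u by (auto simp: dom_subdiff_f_def)
  have int_u: "integrable ?M u" using dom_subdiff_fD(2)[OF u] .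
  have int_exp: "integrable ?M (\<lambda>t. exp (g t / c + \<beta>) * u t)" for \<beta>
    by (rule integrable_bounded_mult[OF int_u, of _ "exp (C / c + \<beta>)"]) (use gc in auto)
  define I where "I = (\<integral>t. exp (g t / c) * u t \<partial>?M)"
  \<comment> \<open>For m = 1, I is the mass of u e^(g / c), and the factor e^(- ln I) rescales it
    to 1.\<close>
  define \<beta> where "\<beta> = (if m = 0 then 0 else - ln I)"
  define p where "p t = exp (g t / c + \<beta>) * u t" for t
  have p_bounds: "AE t in ?M. a * exp (- (C / c) + \<beta>) \<le> p t \<and> p t \<le> b * exp (C / c + \<beta>)"
    using ab(2)
  proof eventually_elim
    case (elim t)
    then show ?case
      unfolding p_def using ab(1) gc[of t]
      by (auto simp: mult.commute[of _ "exp _"] intro!: mult_mono)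
  qed
  have int_p: "integrable ?M p" unfolding p_def by (rule int_exp)
  have p: "p \<in> dom_subdiff_f \<Omega>"
    by (rule dom_subdiff_fI[OF _ _ p_bounds]) (use int_p ab(1) in \<open>auto simp: L1_def\<close>)
  have p_norm: "integral\<^sup>L ?M p = 1" if "m = 1"
  proof -
    have "exp (- (C / c)) * 1 = (\<integral>t. exp (- (C / c)) * u t \<partial>?M)" using u_norm[OF that] by simp
    also have "\<dots> \<le> I"
      unfolding I_def using int_exp[of 0] int_u gc dom_subdiff_fD(3)[OF u]
      by (intro integral_mono_AE) (auto elim!: eventually_mono intro!: mult_right_mono)
    finally have "0 < I" using exp_gt_zero[of "- (C / c)"] by linarith
    have "integral\<^sup>L ?M p = (\<integral>t. exp \<beta> * (exp (g t / c) * u t) \<partial>?M)"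
      unfolding p_def by (simp add: exp_add mult_ac)
    also have "\<dots> = exp \<beta> * I" by (simp add: I_def)
    also have "\<dots> = 1" using \<open>0 < I\<close> that by (simp add: \<beta>_def exp_minus)
    finally show ?thesis .
  qed
  have ln_p: "AE t in ?M. ln (p t) = ln (u t) + g t / c + \<beta>"
    using dom_subdiff_fD(3)[OF u] by eventually_elim (simp add: p_def ln_mult)
  \<comment> \<open>Stated for any representative q of p, because the given minimizer v will agree
    with p only almost everywhere.\<close>
  have int_ln: "(\<integral>t. w t * ln (q t) \<partial>?M) =
      (\<integral>t. w t * ln (u t) \<partial>?M) + r \<bullet> A w / c + \<beta> * (\<integral>t. w t \<partial>?M)"
    if w: "w \<in> L1 \<Omega>" and q: "q \<in> dom_subdiff_f \<Omega>" "AE t in ?M. q t = p t" for w q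
  proof -
    have int_w: "integrable ?M w" using w by (simp add: L1_def)
    have int_gw: "integrable ?M (\<lambda>t. g t * w t)"
      by (rule integrable_bounded_mult[OF int_w g, of C]) (use C in auto)
    note int = dom_subdiff_f_integrable_ln[OF u w] int_w int_gw
    have "(\<integral>t. w t * ln (q t) \<partial>?M) = (\<integral>t. w t * ln (u t) + g t * w t / c + \<beta> * w t \<partial>?M)"
    proof (rule integral_cong_AE)
      show "AE t in ?M. w t * ln (q t) = w t * ln (u t) + g t * w t / c + \<beta> * w t"
        using ln_p q(2) by eventually_elim (simp add: algebra_simps)
      show "(\<lambda>t. w t * ln (q t)) \<in> borel_measurable ?M"
        using dom_subdiff_f_integrable_ln[OF q(1) w] by auto
      show "(\<lambda>t. w t * ln (u t) + g t * w t / c + \<beta> * w t) \<in> borel_measurable ?M"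
        using int by auto
    qed
    then show ?thesis using int gA[OF w] by simp
  qed
  \<comment> \<open>What remains of the objective once \<open>c * kl \<Omega> w p\<close> is split
    off; it does not depend on w.\<close>
  define K where "K = r \<bullet> yd + c * (integral\<^sup>L ?M u - integral\<^sup>L ?M p) + c * \<beta>"
  have obj: "step_objective \<Omega> A m c yd u w = ereal (c * kl \<Omega> w p + K)"
    if w: "w \<in> dom_f \<Omega>" and chi: "chi \<Omega> m w = 0" for w
  proof -
    \<comment> \<open>Feasibility: either \<beta> = 0, or the mass of w is 1.\<close>
    have "\<beta> * (\<integral>t. w t \<partial>?M) = \<beta>"
      using chi by (auto simp: chi_def \<beta>_def split: if_splits)
    then have "kl \<Omega> w u = kl \<Omega> w p + r \<bullet> A w / c + \<beta> + integral\<^sup>L ?M u - integral\<^sup>L ?M p"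
      using int_ln[OF dom_fD(2)[OF w] p] unfolding kl_def by simp
    then have "c * kl \<Omega> w u = c * kl \<Omega> w p + r \<bullet> A w + c * \<beta> + c * integral\<^sup>L ?M u - c * integral\<^sup>L ?M p"
      using c by (simp add: distrib_left right_diff_distrib)
    then have "(A w - yd) \<bullet> (A u - yd) + c * kl \<Omega> w u = c * kl \<Omega> w p + K"
      unfolding K_def r_def by (simp add: algebra_simps inner_commute)
    moreover have "step_objective \<Omega> A m c yd u w = ereal ((A w - yd) \<bullet> (A u - yd) + c * kl \<Omega> w u)"
      unfolding step_objective_def KL_eq_kl[OF w u] chi
      using kl_nonneg[OF w u] by (simp add: enn2ereal_ennreal)
    ultimately show ?thesis by simp
  qed
  have p_f: "p \<in> dom_f \<Omega>" by (rule dom_subdiff_f_subset[OF p])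
  have chi_p: "chi \<Omega> m p = 0" using p_norm m by (auto simp: chi_def)
  have v_f: "v \<in> dom_f \<Omega>" and v_min: "step_objective \<Omega> A m c yd u v \<le> step_objective \<Omega> A m c yd u p"
    using v p_f by (auto simp: is_arg_min_def not_less)
  \<comment> \<open>The objective is finite at p, so a minimizer cannot carry an infinite
    penalty.\<close>
  have chi_v: "chi \<Omega> m v = 0"
  proof (rule ccontr)
    assume "chi \<Omega> m v \<noteq> 0"
    then have "chi \<Omega> m v = \<infinity>" by (auto simp: chi_def split: if_splits)
    then have "step_objective \<Omega> A m c yd u v = \<infinity>"
      unfolding step_objective_def KL_eq_kl[OF v_f u]
      using kl_nonneg[OF v_f u] by (simp add: enn2ereal_ennreal)
    with v_min show False using obj[OF p_f chi_p] by simp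
  qed
  \<comment> \<open>Comparison with the competitor p, at which the divergence to p vanishes.\<close>
  have "c * kl \<Omega> v p \<le> 0"
    using v_min obj[OF p_f chi_p] obj[OF v_f chi_v] by simp
  then have "kl \<Omega> v p = 0"
    using kl_nonneg[OF v_f p] c by (metis mult_pos_pos not_less order_le_less)
  then have v_p: "AE t in ?M. v t = p t" by (rule kl_eq_0D[OF v_f p])
  have v_sub: "v \<in> dom_subdiff_f \<Omega>"
  proof -
    have "AE t in ?M. a * exp (- (C / c) + \<beta>) \<le> v t \<and> v t \<le> b * exp (C / c + \<beta>)"
      using p_bounds v_p by eventually_elim simp
    then show ?thesis
      by (rule dom_subdiff_fI[rotated 2]) (use dom_fD(2)[OF v_f] ab(1) in auto)
  qed
  show ?thesis
  proof (rule that[of \<beta>])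
    show "v \<in> dom_subdiff_f \<Omega>" by (rule v_sub)
    show "(\<integral>t. v t \<partial>?M) = 1" if "m = 1" using chi_v that by (auto simp: chi_def split: if_splits)
    show "\<beta> = 0" if "m = 0" using that by (simp add: \<beta>_def)
  qed (use int_ln[OF _ v_sub v_p] in \<open>auto simp: r_def\<close>)
qed

section \<open>Weak compactness from bounded entropy, and weak limits\<close>

text \<open>The de la Vallee-Poussin criterion: in x <= e^s + (x ln x + 1) / s a large s makes the
  entropy share small, at the price of a factor e^s on the measure of the set. Bounded entropy thus
  gives uniform integrability.\<close>

lemma entropy_weakly_compact:
  fixes u :: "nat \<Rightarrow> 'a::euclidean_space \<Rightarrow> real"
  assumes \<Omega>: "\<Omega> \<in> lmeasurable" and u: "\<And>n. u n \<in> dom_f \<Omega>"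
    and bound: "\<And>n. (\<integral>t. u n t * ln (u n t) \<partial>lebesgue_on \<Omega>) \<le> B"
  obtains r v where "strict_mono (r :: nat \<Rightarrow> nat)" "weakly_converges_L1 \<Omega> (\<lambda>n. u (r n)) v sequentially"
proof -
  let ?M = "lebesgue_on \<Omega>"
  interpret finite_measure ?M by (rule finite_measure_lebesgue_on[OF \<Omega>])
  \<comment> \<open>Since x ln x >= -1, the added 1 makes the integrand nonnegative, so that it may
    be integrated over the whole space when only a subset E matters.\<close>
  define e where "e n t = u n t * ln (u n t) + 1" for n t
  define T where "T = \<bar>B\<bar> + measure ?M (space ?M)"
  have "T \<ge> 0" by (simp add: T_def)
  have int_u: "integrable ?M (u n)" for n using dom_fD(1)[OF u] .
  have int_e: "integrable ?M (e n)" for n unfolding e_def using dom_fD(4)[OF u] by auto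
  have e_le: "integral\<^sup>L ?M (e n) \<le> T" for n
    unfolding e_def T_def using dom_fD(4)[OF u, of n] bound[of n] by simp
  have e_nonneg: "0 \<le> x * ln x + 1" if "0 \<le> x" for x :: real
    using kl_pointwise(1)[OF that, of 1] that by simp
  have split: "x \<le> exp s + (x * ln x + 1) / s" if "0 \<le> x" "0 < s" for x s :: real
  proof (cases "x \<le> exp s")
    case True
    then show ?thesis using e_nonneg[OF that(1)] that(2) by (simp add: add_increasing2)
  next
    case False
    then have "s \<le> ln x" by (meson exp_gt_zero ln_ge_iff not_le order_less_imp_le order_less_trans)
    then have "x * s \<le> x * ln x + 1" using mult_left_mono[OF _ that(1)] by fastforce
    then have "x \<le> (x * ln x + 1) / s" using that(2) by (simp add: pos_le_divide_eq)
    then show ?thesis by (simp add: add_increasing)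
  qed
  have set_bound: "(\<integral>t. u n t * indicator E t \<partial>?M) \<le> exp s * measure ?M E + T / s"
    if E: "E \<in> sets ?M" and s: "0 < s" for n E s
  proof -
    have int: "integrable ?M (\<lambda>t. exp s * indicator E t + e n t / s)"
      using E int_e by (auto simp: emeasure_eq_measure)
    have "(\<integral>t. u n t * indicator E t \<partial>?M) \<le> (\<integral>t. exp s * indicator E t + e n t / s \<partial>?M)"
    proof (rule integral_mono_AE[OF integrable_real_mult_indicator[OF E int_u] int])
      show "AE t in ?M. u n t * indicator E t \<le> exp s * indicator E t + e n t / s"
        using dom_fD(3)[OF u, of n]
      proof eventually_elim
        case (elim t)
        show ?case
          using split[OF elim s] e_nonneg[OF elim] s by (auto simp: e_def indicator_def)
      qed
    qed
    also have "\<dots> = exp s * measure ?M E + integral\<^sup>L ?M (e n) / s"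
      using E int_e sets.sets_into_space[OF E] by (simp add: emeasure_eq_measure inf.absorb1)
    also have "\<dots> \<le> exp s * measure ?M E + T / s"
      using e_le[of n] s by (simp add: divide_right_mono)
    finally show ?thesis .
  qed
  obtain \<A> where \<A>: "countable \<A>" "\<A> \<subseteq> sets ?M"
    "\<And>E e. E \<in> sets ?M \<Longrightarrow> 0 < e \<Longrightarrow> \<exists>F\<in>\<A>. measure ?M ((E - F) \<union> (F - E)) < e"
    using lebesgue_on_countable_dense_sets[OF \<Omega>] by metis
  have unif: "\<exists>d>0. \<forall>n. \<forall>E\<in>sets ?M. measure ?M E < d \<longrightarrow> (\<integral>t. u n t * indicator E t \<partial>?M) < \<epsilon>"
    if "0 < \<epsilon>" for \<epsilon>
  proof -
    \<comment> \<open>s is fixed first, to push T / s below half of \<epsilon>; the admissible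
      measure of E is then chosen to absorb e^s.\<close>
    define s where "s = 2 * (T + 1) / \<epsilon>"
    have s: "0 < s" "T / s < \<epsilon> / 2"
      using \<open>0 < \<epsilon>\<close> \<open>T \<ge> 0\<close> by (auto simp: s_def field_simps)
    have "(\<integral>t. u n t * indicator E t \<partial>?M) < \<epsilon>"
      if "E \<in> sets ?M" "measure ?M E < \<epsilon> / (2 * exp s)" for n E
    proof -
      have "exp s * measure ?M E < \<epsilon> / 2"
        using that(2) by (simp add: field_simps)
      then show ?thesis using set_bound[OF that(1) s(1), of n] s(2) by linarith
    qed
    then show ?thesis using \<open>0 < \<epsilon>\<close> by (intro exI[of _ "\<epsilon> / (2 * exp s)"]) auto
  qed
  have int_le: "integral\<^sup>L ?M (u n) \<le> exp 1 * measure ?M (space ?M) + T" for n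
  proof -
    have "integral\<^sup>L ?M (u n) = (\<integral>t. u n t * indicator (space ?M) t \<partial>?M)"
      by (intro Bochner_Integration.integral_cong) auto
    then show ?thesis using set_bound[OF sets.top, of 1 n] by simp
  qed
  obtain r v where r: "strict_mono (r :: nat \<Rightarrow> nat)" and v: "integrable ?M v"
    and lim: "\<And>g C. g \<in> borel_measurable ?M \<Longrightarrow> (\<And>x. \<bar>g x\<bar> \<le> C) \<Longrightarrow>
       (\<lambda>n. \<integral>x. g x * u (r n) x \<partial>?M) \<longlonglongrightarrow> (\<integral>x. g x * v x \<partial>?M)"
    using L1_weakly_compact[of \<A> u, OF \<A> int_u dom_fD(3)[OF u] int_le unif] by blast
  have "weakly_converges_L1 \<Omega> (\<lambda>n. u (r n)) v sequentially"
    unfolding weakly_converges_L1_def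
  proof (intro conjI allI impI)
    show vL: "v \<in> L1 \<Omega>" using v by (simp add: L1_def)
    show "\<forall>\<^sub>F n in sequentially. u (r n) \<in> L1 \<Omega>" using dom_fD(2)[OF u] by simp
    fix \<phi> :: "('a \<Rightarrow> real) \<Rightarrow> real" assume "bounded_linear_L1 \<Omega> \<phi>"
    then obtain g C where g: "g \<in> borel_measurable ?M" "\<And>x. \<bar>g x\<bar> \<le> C"
      "\<And>u. u \<in> L1 \<Omega> \<Longrightarrow> \<phi> u = (\<integral>t. g t * u t \<partial>?M)"
      using bounded_linear_L1_representation[OF \<Omega>] by blast
    show "(\<lambda>n. \<phi> (u (r n))) \<longlonglongrightarrow> \<phi> v"
      using lim[OF g(1,2)] g(3)[OF vL] g(3)[OF dom_fD(2)[OF u]] by simp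
  qed
  with r show ?thesis by (rule that)
qed

text \<open>Each map v -> <w, A v> is a bounded functional on L^1. The choice w = A v - y turns the
  two limits of <w, A u_i> into |A v - y|^2 = 0.\<close>

lemma weak_limit_solves:
  fixes A :: "('a::euclidean_space \<Rightarrow> real) \<Rightarrow> 'y::real_inner"
  assumes A: "bounded_linear_L1 \<Omega> A" and weak: "weakly_converges_L1 \<Omega> u v F" and "F \<noteq> bot"
    and lim: "((\<lambda>i. A (u i)) \<longlongrightarrow> y) F"
  shows "A v = y"
proof -
  define w where "w = A v - y"
  have "((\<lambda>i. w \<bullet> A (u i)) \<longlongrightarrow> w \<bullet> A v) F"
    using weak bounded_linear_L1_inner[OF A] unfolding weakly_converges_L1_def by blast
  moreover have "((\<lambda>i. w \<bullet> A (u i)) \<longlongrightarrow> w \<bullet> y) F" by (intro tendsto_inner tendsto_const lim)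
  ultimately have "w \<bullet> A v = w \<bullet> y" using \<open>F \<noteq> bot\<close> tendsto_unique by blast
  then have "w \<bullet> w = 0" by (simp add: w_def inner_diff_right)
  then show ?thesis by (simp add: w_def)
qed

text \<open>Subsequence principle: if a functional fails to converge, some null sequence keeps its
  values at least e away from the limit, and a subsequence of that sequence contradicts
  \<open>sub\<close>.\<close>

lemma weakly_converges_at_right:
  fixes u :: "real \<Rightarrow> 'a::euclidean_space \<Rightarrow> real"
  assumes "0 < \<delta>0" and z: "z \<in> L1 \<Omega>" and u: "\<And>\<delta>. \<delta> \<in> {0<..\<delta>0} \<Longrightarrow> u \<delta> \<in> L1 \<Omega>"
    and sub: "\<And>\<delta>s. (\<And>n. \<delta>s n \<in> {0<..\<delta>0}) \<Longrightarrow> \<delta>s \<longlonglongrightarrow> 0 \<Longrightarrow>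
      \<exists>r. strict_mono r \<and> weakly_converges_L1 \<Omega> (\<lambda>n. u (\<delta>s (r n))) z sequentially"
  shows "weakly_converges_L1 \<Omega> u z (at_right 0)"
  unfolding weakly_converges_L1_def
proof (intro conjI allI impI)
  show "z \<in> L1 \<Omega>" by (rule z)
  show "\<forall>\<^sub>F \<delta> in at_right 0. u \<delta> \<in> L1 \<Omega>"
    using eventually_at_right_real[OF \<open>0 < \<delta>0\<close>] by eventually_elim (rule u, auto)
  fix \<phi> :: "('a \<Rightarrow> real) \<Rightarrow> real" assume \<phi>: "bounded_linear_L1 \<Omega> \<phi>"
  show "((\<lambda>\<delta>. \<phi> (u \<delta>)) \<longlongrightarrow> \<phi> z) (at_right 0)"
  proof (rule tendstoI, rule sequentially_imp_eventually_at_right[OF \<open>0 < \<delta>0\<close>], rule ccontr)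
    fix e :: real and \<delta>s :: "nat \<Rightarrow> real"
    assume "0 < e" and \<delta>s: "\<And>n. 0 < \<delta>s n" "\<And>n. \<delta>s n < \<delta>0" "\<delta>s \<longlonglongrightarrow> 0"
      and "\<not> (\<forall>\<^sub>F n in sequentially. dist (\<phi> (u (\<delta>s n))) (\<phi> z) < e)"
    then obtain s where s: "strict_mono (s :: nat \<Rightarrow> nat)" "\<And>n. \<not> dist (\<phi> (u (\<delta>s (s n)))) (\<phi> z) < e"
      using not_eventually_sequentiallyD[of "\<lambda>n. dist (\<phi> (u (\<delta>s n))) (\<phi> z) < e"] by auto
    have "(\<lambda>n. \<delta>s (s n)) \<longlonglongrightarrow> 0"
      using LIMSEQ_subseq_LIMSEQ[OF \<delta>s(3) s(1)] by (simp add: o_def)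
    then obtain r where "weakly_converges_L1 \<Omega> (\<lambda>n. u (\<delta>s (s (r n)))) z sequentially"
      using sub[of "\<lambda>n. \<delta>s (s n)"] \<delta>s(1,2) by (auto simp: less_imp_le)
    then have "(\<lambda>n. \<phi> (u (\<delta>s (s (r n))))) \<longlonglongrightarrow> \<phi> z"
      using \<phi> unfolding weakly_converges_L1_def by blast
    from tendstoD[OF this \<open>0 < e\<close>] show False using s(2) by simp
  qed
qed

lemma weakly_converges_L1_cong_limit:
  assumes weak: "weakly_converges_L1 \<Omega> u v F" and z: "z \<in> L1 \<Omega>"
    and eq: "AE t in lebesgue_on \<Omega>. v t = z t"
  shows "weakly_converges_L1 \<Omega> u z F"
proof -
  have v: "v \<in> L1 \<Omega>" using weak by (simp add: weakly_converges_L1_def)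
  have "\<phi> v = \<phi> z" if "bounded_linear_L1 \<Omega> \<phi>" for \<phi> :: "('a \<Rightarrow> real) \<Rightarrow> real"
    by (rule bounded_linear_L1_cong_AE[OF that v z eq])
  then show ?thesis using weak z unfolding weakly_converges_L1_def by metis
qed

subsection \<open>The entropic Landweber iteration\<close>

text \<open>One fixed noise level. The assumption \<open>descent\<close> is the common form of D >=
  0 for both values of m, restricted to the points where the iterates live and where
  \<open>kl\<close> is the true divergence.\<close>

locale entropic_landweber =
  fixes \<Omega> :: "'a::euclidean_space set" and A :: "('a \<Rightarrow> real) \<Rightarrow> 'y::real_inner"
    and m :: nat and c \<delta> :: real and y yd :: 'y and z u0 :: "'a \<Rightarrow> real" and u :: "nat \<Rightarrow> 'a \<Rightarrow> real"
  assumes lmeasurable: "\<Omega> \<in> lmeasurable" and m: "m \<in> {0, 1}" and c: "c > 0"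
    and A: "bounded_linear_L1 \<Omega> A"
    and z: "z \<in> dom_f \<Omega>" "A z = y" "m = 1 \<Longrightarrow> (\<integral>t. z t \<partial>lebesgue_on \<Omega>) = 1"
    and noise: "norm (y - yd) \<le> \<delta>"
    and u0: "u0 \<in> dom_subdiff_f \<Omega>" "m = 1 \<Longrightarrow> (\<integral>t. u0 t \<partial>lebesgue_on \<Omega>) = 1"
    and iterates: "is_iterates \<Omega> A m c yd u0 u"
    and descent: "\<And>v w. v \<in> dom_subdiff_f \<Omega> \<Longrightarrow> w \<in> dom_subdiff_f \<Omega> \<Longrightarrow>
      (m = 1 \<Longrightarrow> (\<integral>t. v t \<partial>lebesgue_on \<Omega>) = 1) \<Longrightarrow> (m = 1 \<Longrightarrow> (\<integral>t. w t \<partial>lebesgue_on \<Omega>) = 1) \<Longrightarrow>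
      (norm (A v - A w))\<^sup>2 / 2 \<le> c * kl \<Omega> v w"
begin

definition r :: "nat \<Rightarrow> 'y" where "r k = yd - A (u k)"

lemma u_Suc: "is_arg_min (step_objective \<Omega> A m c yd (u k)) (\<lambda>v. v \<in> dom_f \<Omega>) (u (Suc k))"
  and u_0: "u 0 = u0"
  using iterates by (auto simp: is_iterates_def)

lemma iterate_dom: "u k \<in> dom_subdiff_f \<Omega> \<and> (m = 1 \<longrightarrow> (\<integral>t. u k t \<partial>lebesgue_on \<Omega>) = 1)"
proof (induction k)
  case 0
  then show ?case using u0 by (simp add: u_0)
next
  case (Suc k)
  then have "u k \<in> dom_subdiff_f \<Omega>" "m = 1 \<Longrightarrow> (\<integral>t. u k t \<partial>lebesgue_on \<Omega>) = 1" by auto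
  from step_minimizer[OF lmeasurable m c A this u_Suc] show ?case by metis
qed

lemmas u_dom = iterate_dom[THEN conjunct1]
lemmas u_norm = iterate_dom[THEN conjunct2, rule_format]
lemmas u_L1 = dom_subdiff_fD(1)[OF u_dom]

text \<open>The recursion ln u_(k+1) = ln u_k + A* r_k / c + \<beta>, tested against L^1 functions
  so that no representative of A* r_k has to be carried along.\<close>

lemma step_log:
  obtains \<beta> where "m = 0 \<Longrightarrow> \<beta> = 0"
    "\<And>w. w \<in> L1 \<Omega> \<Longrightarrow> (\<integral>t. w t * ln (u (Suc k) t) \<partial>lebesgue_on \<Omega>) =
       (\<integral>t. w t * ln (u k t) \<partial>lebesgue_on \<Omega>) + r k \<bullet> A w / c + \<beta> * (\<integral>t. w t \<partial>lebesgue_on \<Omega>)"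
  by (rule step_minimizer[OF lmeasurable m c A u_dom u_norm u_Suc, of k]) (auto simp: r_def intro: that)

text \<open>Disposes of the normalizing constants: without the mass constraint they are 0, with it
  both masses are 1.\<close>

lemma norm_cancel:
  assumes "m = 0 \<Longrightarrow> \<beta> = 0" "m = 1 \<Longrightarrow> a = 1" "m = 1 \<Longrightarrow> b = (1 :: real)"
  shows "\<beta> * a = \<beta> * b"
  using assms m by auto

text \<open>After expanding \<open>kl\<close>, only the terms integrating against ln u_(k+1) and ln
  u_k survive; \<open>step_log\<close>, taken at w and at u_(k+1), evaluates their difference, and
  \<beta> cancels by equality of masses.\<close>

lemma kl_three_point:
  assumes w: "w \<in> dom_f \<Omega>" "m = 1 \<Longrightarrow> (\<integral>t. w t \<partial>lebesgue_on \<Omega>) = 1"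
  shows "c * kl \<Omega> w (u (Suc k)) + c * kl \<Omega> (u (Suc k)) (u k) =
    c * kl \<Omega> w (u k) - r k \<bullet> (A w - A (u (Suc k)))"
proof -
  obtain \<beta> where \<beta>: "m = 0 \<Longrightarrow> \<beta> = 0" and log:
    "\<And>w. w \<in> L1 \<Omega> \<Longrightarrow> (\<integral>t. w t * ln (u (Suc k) t) \<partial>lebesgue_on \<Omega>) =
       (\<integral>t. w t * ln (u k t) \<partial>lebesgue_on \<Omega>) + r k \<bullet> A w / c + \<beta> * (\<integral>t. w t \<partial>lebesgue_on \<Omega>)"
    using step_log by blast
  have "kl \<Omega> w (u (Suc k)) + kl \<Omega> (u (Suc k)) (u k) =
      kl \<Omega> w (u k) - (r k \<bullet> A w / c - r k \<bullet> A (u (Suc k)) / c)"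
    using log[OF dom_fD(2)[OF w(1)]] log[OF u_L1[of "Suc k"]] norm_cancel[OF \<beta> w(2) u_norm[of "Suc k"]]
    unfolding kl_def by simp
  then have "c * (kl \<Omega> w (u (Suc k)) + kl \<Omega> (u (Suc k)) (u k)) =
      c * (kl \<Omega> w (u k) - (r k \<bullet> A w / c - r k \<bullet> A (u (Suc k)) / c))" by simp
  then show ?thesis using c by (simp add: algebra_simps inner_diff_right)
qed

lemma step_descent: "(norm (r k - r (Suc k)))\<^sup>2 / 2 \<le> c * kl \<Omega> (u (Suc k)) (u k)"
  using descent[OF u_dom u_dom u_norm u_norm, of "Suc k" k] by (simp add: r_def)

text \<open>The three-point identity at w = u_k bounds |r_k - r_(k+1)|^2 / 2 by <r_k, r_k -
  r_(k+1)>; expanding both sides leaves exactly the monotonicity of the squared norms.\<close>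

lemma residual_Suc_le: "norm (r (Suc k)) \<le> norm (r k)"
proof -
  have "c * kl \<Omega> (u k) (u (Suc k)) + c * kl \<Omega> (u (Suc k)) (u k) = r k \<bullet> (r k - r (Suc k))"
    using kl_three_point[OF dom_subdiff_f_subset[OF u_dom] u_norm, of k k]
    by (simp add: r_def inner_diff_right)
  moreover have "0 \<le> c * kl \<Omega> (u k) (u (Suc k))"
    using kl_nonneg[OF dom_subdiff_f_subset[OF u_dom] u_dom] c by simp
  ultimately have "(norm (r k - r (Suc k)))\<^sup>2 / 2 \<le> r k \<bullet> (r k - r (Suc k))"
    using step_descent[of k] by linarith
  then have "(norm (r (Suc k)))\<^sup>2 \<le> (norm (r k))\<^sup>2"
    unfolding power2_norm_eq_inner by (simp add: inner_diff_left inner_diff_right inner_commute field_simps)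
  then show ?thesis using power2_le_imp_le norm_ge_zero by blast
qed

lemma residual_antimono: "k \<le> n \<Longrightarrow> norm (r n) \<le> norm (r k)"
  by (rule lift_Suc_antimono_le[of "\<lambda>k. norm (r k)"]) (rule residual_Suc_le)

text \<open>The three-point identity at w = z, with <r_k, r_(k+1)> polarized:
  \<open>step_descent\<close> absorbs |r_k - r_(k+1)|^2 / 2, and Young's inequality for the noise
  term produces |r_k|^2 / 2, which cancels.\<close>

lemma kl_step: "c * kl \<Omega> z (u (Suc k)) + (norm (r (Suc k)))\<^sup>2 / 2 \<le> c * kl \<Omega> z (u k) + \<delta>\<^sup>2 / 2"
proof -
  have "- (r k \<bullet> (y - A (u (Suc k)))) = - (r k \<bullet> r (Suc k)) + r k \<bullet> (yd - y)"
    by (simp add: r_def inner_diff_right)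
  moreover have "- (r k \<bullet> r (Suc k)) =
      (norm (r k - r (Suc k)))\<^sup>2 / 2 - (norm (r k))\<^sup>2 / 2 - (norm (r (Suc k)))\<^sup>2 / 2"
    unfolding power2_norm_eq_inner by (simp add: inner_diff_left inner_diff_right inner_commute field_simps)
  moreover have "r k \<bullet> (yd - y) \<le> (norm (r k))\<^sup>2 / 2 + \<delta>\<^sup>2 / 2"
  proof -
    have "r k \<bullet> (yd - y) \<le> norm (r k) * norm (yd - y)" by (rule norm_cauchy_schwarz)
    also have "\<dots> \<le> norm (r k) * \<delta>"
      using noise by (intro mult_left_mono) (auto simp: norm_minus_commute)
    also have "\<dots> \<le> (norm (r k))\<^sup>2 / 2 + \<delta>\<^sup>2 / 2"
      using sum_squares_bound[of "norm (r k)" \<delta>] by simp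
    finally show ?thesis .
  qed
  ultimately show ?thesis
    using kl_three_point[OF z(1,3), of k] step_descent[of k] unfolding z(2) by linarith
qed

lemma kl_sum:
  "c * kl \<Omega> z (u n) + (\<Sum>k<n. (norm (r (Suc k)))\<^sup>2) / 2 \<le> c * kl \<Omega> z u0 + n * \<delta>\<^sup>2 / 2"
proof (induction n)
  case (Suc n)
  then show ?case using kl_step[of n] by (simp add: add_divide_distrib distrib_right)
qed (simp add: u_0)

text \<open>A common bound for all estimates after n steps. The term in \<open>r 0\<close> appears
  because the descent estimate controls residuals from index 1 on, whereas the sum in w_n starts at
  index 0.\<close>

definition P :: "nat \<Rightarrow> real" where
  "P n = (norm (r 0))\<^sup>2 + 2 * c * kl \<Omega> z u0 + n * \<delta>\<^sup>2"

lemma kl_z_nonneg: "0 \<le> c * kl \<Omega> z (u n)"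
  using kl_nonneg[OF z(1) u_dom] c by simp

lemma kl_z_le: "2 * c * kl \<Omega> z (u n) \<le> P n"
  and sum_residual_Suc_le: "(\<Sum>k<n. (norm (r (Suc k)))\<^sup>2) \<le> 2 * c * kl \<Omega> z u0 + n * \<delta>\<^sup>2"
proof -
  have "0 \<le> (\<Sum>k<n. (norm (r (Suc k)))\<^sup>2)" by (intro sum_nonneg) auto
  with kl_sum[of n] have "2 * c * kl \<Omega> z (u n) \<le> 2 * c * kl \<Omega> z u0 + n * \<delta>\<^sup>2" by simp
  also have "\<dots> \<le> P n" by (simp add: P_def)
  finally show "2 * c * kl \<Omega> z (u n) \<le> P n" .
  show "(\<Sum>k<n. (norm (r (Suc k)))\<^sup>2) \<le> 2 * c * kl \<Omega> z u0 + n * \<delta>\<^sup>2"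
    using kl_sum[of n] kl_z_nonneg[of n] by simp
qed

text \<open>By monotonicity the last residual is the smallest of the n summands controlled by
  \<open>kl_sum\<close>.\<close>

lemma residual_rate: "n * (norm (r n))\<^sup>2 \<le> P n"
proof -
  have "n * (norm (r n))\<^sup>2 = (\<Sum>k<n. (norm (r n))\<^sup>2)" by simp
  also have "\<dots> \<le> (\<Sum>k<n. (norm (r (Suc k)))\<^sup>2)"
    by (intro sum_mono power_mono residual_antimono) auto
  also have "\<dots> \<le> P n"
    using sum_residual_Suc_le[of n] zero_le_power2[of "norm (r 0)"] unfolding P_def by linarith
  finally show ?thesis .
qed

lemma sum_residual_le: "(\<Sum>k<n. (norm (r k))\<^sup>2) \<le> P n"
proof -
  have "(\<Sum>k<n. (norm (r k))\<^sup>2) \<le> (\<Sum>k<Suc n. (norm (r k))\<^sup>2)" by simp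
  also have "\<dots> = (norm (r 0))\<^sup>2 + (\<Sum>k<n. (norm (r (Suc k)))\<^sup>2)"
    by (rule sum.lessThan_Suc_shift)
  also have "\<dots> \<le> P n" using sum_residual_Suc_le[of n] by (simp add: P_def)
  finally show ?thesis .
qed

lemma P_nonneg: "0 \<le> P n"
  using kl_z_le[of n] kl_z_nonneg[of n] by simp

text \<open>Cauchy-Schwarz bounds the squared sum by n times the sum of squares; the factor n is
  paid for by x^2. Needed for x = |r_n| and for x = \<delta>.\<close>

lemma sum_residual_times:
  assumes "0 \<le> x" "n * x\<^sup>2 \<le> P n"
  shows "(\<Sum>k<n. norm (r k)) * x \<le> P n"
proof (rule power2_le_imp_le[OF _ P_nonneg])
  have "((\<Sum>k<n. norm (r k)) * x)\<^sup>2 \<le> ((\<Sum>k<n. (norm (r k))\<^sup>2) * n) * x\<^sup>2"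
    unfolding power_mult_distrib
    using sum_squared_le_sum_of_squares[of "\<lambda>k. norm (r k)" "{..<n}"] by (intro mult_right_mono) auto
  also have "\<dots> = (\<Sum>k<n. (norm (r k))\<^sup>2) * (n * x\<^sup>2)" by simp
  also have "\<dots> \<le> P n * P n"
    by (intro mult_mono sum_residual_le assms P_nonneg) auto
  finally show "((\<Sum>k<n. norm (r k)) * x)\<^sup>2 \<le> (P n)\<^sup>2" by (simp add: power2_eq_square)
qed

section \<open>Logarithms of the iterates and the entropy bound\<close>

text \<open>Summation of \<open>step_log\<close>, started by the source condition: the -1 is the
  constant in 1 + ln u_0 = A* w_0, and \<beta> collects the normalizing constants.\<close>

lemma log_iterates:
  assumes w0: "is_adjoint_value \<Omega> A w0 (\<lambda>t. 1 + ln (u0 t))"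
  shows "\<exists>\<beta>. (m = 0 \<longrightarrow> \<beta> = 0) \<and> (\<forall>w\<in>L1 \<Omega>. (\<integral>t. w t * ln (u n t) \<partial>lebesgue_on \<Omega>) =
    (w0 + (\<Sum>k<n. r k) /\<^sub>R c) \<bullet> A w + (\<beta> - 1) * (\<integral>t. w t \<partial>lebesgue_on \<Omega>))"
proof (induction n)
  case 0
  have "(\<integral>t. w t * ln (u0 t) \<partial>lebesgue_on \<Omega>) = w0 \<bullet> A w - (\<integral>t. w t \<partial>lebesgue_on \<Omega>)"
    if w: "w \<in> L1 \<Omega>" for w
  proof -
    have "w0 \<bullet> A w = (\<integral>t. w t + w t * ln (u0 t) \<partial>lebesgue_on \<Omega>)"
      using w0 w by (auto simp: is_adjoint_value_def algebra_simps)
    then show ?thesis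
      using dom_subdiff_f_integrable_ln[OF u0(1) w] w by (simp add: L1_def)
  qed
  then show ?case by (intro exI[of _ 0]) (simp add: u_0)
next
  case (Suc n)
  then obtain \<beta> where \<beta>: "m = 0 \<Longrightarrow> \<beta> = 0" "\<And>w. w \<in> L1 \<Omega> \<Longrightarrow> (\<integral>t. w t * ln (u n t) \<partial>lebesgue_on \<Omega>) =
    (w0 + (\<Sum>k<n. r k) /\<^sub>R c) \<bullet> A w + (\<beta> - 1) * (\<integral>t. w t \<partial>lebesgue_on \<Omega>)" by blast
  obtain \<beta>' where \<beta>': "m = 0 \<Longrightarrow> \<beta>' = 0"
    "\<And>w. w \<in> L1 \<Omega> \<Longrightarrow> (\<integral>t. w t * ln (u (Suc n) t) \<partial>lebesgue_on \<Omega>) =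
       (\<integral>t. w t * ln (u n t) \<partial>lebesgue_on \<Omega>) + r n \<bullet> A w / c + \<beta>' * (\<integral>t. w t \<partial>lebesgue_on \<Omega>)"
    using step_log by blast
  show ?case
    by (intro exI[of _ "\<beta> + \<beta>'"])
      (use \<beta> \<beta>' in \<open>auto simp: inner_add_left algebra_simps divide_inverse\<close>)
qed

text \<open>Of the three multiples of \<open>P n / c\<close>, two come from pairing the accumulated
  residuals with the last residual and with the noise, and one from the divergence to z.\<close>

lemma entropy_bound:
  assumes w0: "is_adjoint_value \<Omega> A w0 (\<lambda>t. 1 + ln (u0 t))"
  shows "\<bar>(\<integral>t. u n t * ln (u n t) \<partial>lebesgue_on \<Omega>) - (\<integral>t. z t * ln (z t) \<partial>lebesgue_on \<Omega>)\<bar>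
    \<le> norm w0 * (norm (r 0) + \<delta>) + 3 * P n / c"
proof -
  let ?f = "\<lambda>v. \<integral>t. v t * ln (v t) \<partial>lebesgue_on \<Omega>"
  define w where "w = w0 + (\<Sum>k<n. r k) /\<^sub>R c"
  obtain \<beta> where \<beta>: "m = 0 \<Longrightarrow> \<beta> = 0" "\<And>v. v \<in> L1 \<Omega> \<Longrightarrow> (\<integral>t. v t * ln (u n t) \<partial>lebesgue_on \<Omega>) =
    w \<bullet> A v + (\<beta> - 1) * (\<integral>t. v t \<partial>lebesgue_on \<Omega>)"
    using log_iterates[OF w0, of n] unfolding w_def by blast
  \<comment> \<open>The formula for ln u_n is tested with u_n and with z; the -1 cancels the mass
    terms of \<open>kl\<close>, and \<beta> drops out by equality of masses.\<close>
  have eq: "?f (u n) - ?f z = w \<bullet> (A (u n) - y) - kl \<Omega> z (u n)"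
    using \<beta>(2)[OF u_L1] \<beta>(2)[OF dom_fD(2)[OF z(1)]] norm_cancel[OF \<beta>(1) u_norm z(3), of n]
    unfolding kl_def z(2) by (simp add: inner_diff_right left_diff_distrib)
  define S where "S = (\<Sum>k<n. norm (r k))"
  have "0 \<le> \<delta>" using noise norm_ge_zero order_trans by blast
  have res: "norm (A (u n) - y) \<le> norm (r n) + \<delta>"
    using norm_triangle_ineq[of "r n" "y - yd"] noise by (simp add: r_def norm_minus_commute)
  have "norm w \<le> norm w0 + norm ((\<Sum>k<n. r k) /\<^sub>R c)" unfolding w_def by (rule norm_triangle_ineq)
  also have "\<dots> \<le> norm w0 + S / c"
    using c norm_sum[of r "{..<n}"] by (simp add: S_def divide_inverse mult.commute)
  finally have norm_w: "norm w \<le> norm w0 + S / c" .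
  have "0 \<le> S" unfolding S_def by (intro sum_nonneg) auto
  have "n * \<delta>\<^sup>2 \<le> P n" using kl_z_nonneg[of 0] by (simp add: P_def u_0)
  then have S1: "S * norm (r n) \<le> P n" "S * \<delta> \<le> P n"
    unfolding S_def using residual_rate \<open>0 \<le> \<delta>\<close> by (auto intro: sum_residual_times)
  have "\<bar>w \<bullet> (A (u n) - y)\<bar> \<le> norm w * norm (A (u n) - y)" by (rule Cauchy_Schwarz_ineq2)
  also have "\<dots> \<le> (norm w0 + S / c) * (norm (r n) + \<delta>)"
    using norm_w res \<open>0 \<le> S\<close> c by (intro mult_mono) auto
  also have "\<dots> = norm w0 * (norm (r n) + \<delta>) + (S * norm (r n) + S * \<delta>) / c"
    by (simp add: distrib_left distrib_right add_divide_distrib)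
  also have "\<dots> \<le> norm w0 * (norm (r 0) + \<delta>) + (P n + P n) / c"
    using S1 c residual_antimono[of 0 n] by (intro add_mono mult_left_mono divide_right_mono) auto
  finally have bd: "\<bar>w \<bullet> (A (u n) - y)\<bar> \<le> norm w0 * (norm (r 0) + \<delta>) + 2 * P n / c" by simp
  have "kl \<Omega> z (u n) * c \<le> P n"
    using kl_z_le[of n] kl_z_nonneg[of n] by (simp add: mult_ac)
  then have "kl \<Omega> z (u n) \<le> P n / c" using c by (simp add: pos_le_divide_eq)
  moreover have "0 \<le> kl \<Omega> z (u n)" by (rule kl_nonneg[OF z(1) u_dom])
  moreover have "3 * P n / c = 2 * P n / c + P n / c" by (simp add: add_divide_distrib flip: distrib_right)
  ultimately show ?thesis unfolding eq using bd by linarith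
qed

end

section \<open>Uniformity in the noise level and passage to the limit\<close>

theorem proposition3p4:
  fixes \<Omega> :: "'a::euclidean_space set"
    and A :: "('a \<Rightarrow> real) \<Rightarrow> 'y::{real_inner, complete_space}"
    and y :: 'y and m :: nat and c \<gamma> \<delta>0 :: real
    and z u0 :: "'a \<Rightarrow> real"
    and ydelta :: "real \<Rightarrow> 'y"
    and u :: "real \<Rightarrow> nat \<Rightarrow> 'a \<Rightarrow> real"
    and kstar :: "real \<Rightarrow> nat"
  assumes "open \<Omega>" and "bounded \<Omega>"
    and "m \<in> {0, 1}"
    and "c > 0"
    and "bounded_linear_L1 \<Omega> A"
    and "\<gamma> > 0"
    and "\<forall>v\<in>dom_f_chi \<Omega> m. \<forall>w\<in>dom_f_chi \<Omega> m.
           KL \<Omega> v w < \<infinity> \<longrightarrow> norm (A v - A w) \<le> \<gamma> * sqrt (enn2real (KL \<Omega> v w))"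
    and "m = 0 \<Longrightarrow> \<forall>v\<in>dom_f \<Omega>. \<forall>w\<in>dom_subdiff_f \<Omega>. D_functional \<Omega> A c v w \<ge> 0"
    and "m = 1 \<Longrightarrow> c \<ge> \<gamma>\<^sup>2 / 2"
    and "z \<in> dom_f \<Omega>" and "AE t in lebesgue_on \<Omega>. 0 < z t" and "A z = y"
    and "m = 1 \<Longrightarrow> chi \<Omega> m z = 0"
    and "\<delta>0 > 0"
    and "\<forall>\<delta>\<in>{0<..\<delta>0}. norm (y - ydelta \<delta>) \<le> \<delta>"
    and "u0 \<in> dom_subdiff_f \<Omega>"
    and "(\<lambda>t. 1 + ln (u0 t)) \<in> range_adjoint \<Omega> A"
    and "m = 1 \<Longrightarrow> chi \<Omega> m u0 = 0"
    and "\<forall>\<delta>\<in>{0<..\<delta>0}. is_iterates \<Omega> A m c (ydelta \<delta>) u0 (u \<delta>)"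
    and "of_order_inverse \<delta>0 kstar"
  shows "(\<exists>B. \<forall>\<delta>\<in>{0<..\<delta>0}. \<bar>neg_entropy \<Omega> (u \<delta> (kstar \<delta>))\<bar> \<le> ereal B) \<and>
    (\<forall>\<delta>s. (\<forall>n. \<delta>s n \<in> {0<..\<delta>0}) \<and> \<delta>s \<longlonglongrightarrow> 0 \<longrightarrow>
       (\<exists>r v. strict_mono r \<and> v \<in> L1 \<Omega> \<and> A v = y \<and>
          weakly_converges_L1 \<Omega> (\<lambda>n. u (\<delta>s (r n)) (kstar (\<delta>s (r n)))) v sequentially)) \<and>
    ((\<forall>v\<in>L1 \<Omega>. A v = y \<longrightarrow> (AE t in lebesgue_on \<Omega>. v t = z t)) \<longrightarrow>
       weakly_converges_L1 \<Omega> (\<lambda>\<delta>. u \<delta> (kstar \<delta>)) z (at_right 0))"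
proof -
  let ?f = "\<lambda>v. \<integral>t. v t * ln (v t) \<partial>lebesgue_on \<Omega>"
  note A = assms(5) and \<gamma>_bound = assms(7)
  have \<Omega>: "\<Omega> \<in> lmeasurable" using assms(1,2) by (rule lmeasurable_open[rotated])
  have chi1: "(\<integral>t. v t \<partial>lebesgue_on \<Omega>) = 1" if "m = 1" "chi \<Omega> m v = 0" for v
    using that by (auto simp: chi_def split: if_splits)
  \<comment> \<open>For m = 0 this is D >= 0 itself; for m = 1 the \<gamma>-bound is squared and
    \<gamma>^2 <= 2 c is used.\<close>
  have descent: "(norm (A v - A w))\<^sup>2 / 2 \<le> c * kl \<Omega> v w"
    if v: "v \<in> dom_subdiff_f \<Omega>" and w: "w \<in> dom_subdiff_f \<Omega>"
      and "m = 1 \<Longrightarrow> (\<integral>t. v t \<partial>lebesgue_on \<Omega>) = 1" "m = 1 \<Longrightarrow> (\<integral>t. w t \<partial>lebesgue_on \<Omega>) = 1" for v w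
  proof (cases "m = 0")
    case True
    have "D_functional \<Omega> A c v w \<ge> 0" using assms(8)[OF True] dom_subdiff_f_subset[OF v] w by blast
    then show ?thesis
      unfolding D_functional_def KL_eq_kl[OF dom_subdiff_f_subset[OF v] w]
      using kl_nonneg[OF dom_subdiff_f_subset[OF v] w] by (simp add: enn2ereal_ennreal)
  next
    case False
    then have m1: "m = 1" using assms(3) by auto
    note kl0 = kl_nonneg[OF dom_subdiff_f_subset[OF v] w]
    have dom: "x \<in> dom_f_chi \<Omega> m" if "x \<in> dom_subdiff_f \<Omega>" "(\<integral>t. x t \<partial>lebesgue_on \<Omega>) = 1" for x
      using dom_subdiff_f_subset[OF that(1)] that(2) by (simp add: dom_f_chi_def dom_f_def chi_def)
    have "norm (A v - A w) \<le> \<gamma> * sqrt (kl \<Omega> v w)"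
      using \<gamma>_bound dom[OF v that(3)[OF m1]] dom[OF w that(4)[OF m1]] kl0
      unfolding KL_eq_kl[OF dom_subdiff_f_subset[OF v] w, symmetric]
      by (metis KL_eq_kl[OF dom_subdiff_f_subset[OF v] w] enn2real_ennreal ennreal_less_top infinity_ennreal_def)
    then have "(norm (A v - A w))\<^sup>2 \<le> (\<gamma> * sqrt (kl \<Omega> v w))\<^sup>2" by (intro power_mono) auto
    also have "\<dots> = \<gamma>\<^sup>2 * kl \<Omega> v w" using kl0 by (simp add: power_mult_distrib)
    also have "\<dots> \<le> (2 * c) * kl \<Omega> v w" using assms(9)[OF m1] kl0 by (intro mult_right_mono) auto
    finally show ?thesis by simp
  qed
  have loc: "entropic_landweber \<Omega> A m c \<delta> y (ydelta \<delta>) z u0 (u \<delta>)" if "\<delta> \<in> {0<..\<delta>0}" for \<delta>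
    by unfold_locales (use that \<Omega> assms(3,4,10,12,13,15,16,18,19) A descent chi1 in blast)+
  obtain w0 where w0: "is_adjoint_value \<Omega> A w0 (\<lambda>t. 1 + ln (u0 t))"
    using assms(17) by (auto simp: range_adjoint_def)
  obtain a b where "a > 0" "b > 0"
    and k: "\<And>\<delta>. \<delta> \<in> {0<..\<delta>0} \<Longrightarrow> a * (1 / \<delta>) \<le> kstar \<delta> \<and> kstar \<delta> \<le> b * (1 / \<delta>)"
    using assms(20) by (auto simp: of_order_inverse_def)
  \<comment> \<open>R bounds the initial residual and Q bounds \<open>P (kstar \<delta>)\<close>,
    uniformly in \<delta>; the last term of Q comes from n \<delta>^2 = (n \<delta>) \<delta> <= b
    \<delta>0.\<close>
  define R where "R = norm (y - A u0) + \<delta>0"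
  define Q where "Q = R\<^sup>2 + 2 * c * kl \<Omega> z u0 + b * \<delta>0"
  have est: "\<bar>?f (u \<delta> (kstar \<delta>)) - ?f z\<bar> \<le> norm w0 * (R + \<delta>0) + 3 * Q / c"
      "(norm (ydelta \<delta> - A (u \<delta> (kstar \<delta>))))\<^sup>2 \<le> Q / a * \<delta>"
      "u \<delta> (kstar \<delta>) \<in> dom_f \<Omega>"
    if \<delta>: "\<delta> \<in> {0<..\<delta>0}" for \<delta>
  proof -
    interpret L: entropic_landweber \<Omega> A m c \<delta> y "ydelta \<delta>" z u0 "u \<delta>" by (rule loc[OF \<delta>])
    let ?n = "kstar \<delta>"
    have "0 < \<delta>" "\<delta> \<le> \<delta>0" using \<delta> by auto
    have k\<delta>: "a \<le> ?n * \<delta>" "?n * \<delta> \<le> b" using k[OF \<delta>] \<open>0 < \<delta>\<close> by (auto simp: field_simps)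
    have r0: "norm (L.r 0) \<le> R"
      using norm_triangle_ineq[of "ydelta \<delta> - y" "y - A u0"] L.noise \<open>\<delta> \<le> \<delta>0\<close>
      by (simp add: L.r_def L.u_0 R_def norm_minus_commute)
    have "?n * \<delta>\<^sup>2 = (?n * \<delta>) * \<delta>" by (simp add: power2_eq_square)
    also have "\<dots> \<le> b * \<delta>0"
      using k\<delta> \<open>0 < \<delta>\<close> \<open>\<delta> \<le> \<delta>0\<close> \<open>b > 0\<close> by (intro mult_mono) auto
    finally have "?n * \<delta>\<^sup>2 \<le> b * \<delta>0" .
    moreover have "(norm (L.r 0))\<^sup>2 \<le> R\<^sup>2" using r0 by (intro power_mono) auto
    ultimately have P: "L.P ?n \<le> Q" unfolding L.P_def Q_def by linarith
    have "norm w0 * (norm (L.r 0) + \<delta>) + 3 * L.P ?n / c \<le> norm w0 * (R + \<delta>0) + 3 * Q / c"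
      using r0 \<open>\<delta> \<le> \<delta>0\<close> P assms(4)
      by (intro add_mono mult_left_mono divide_right_mono) auto
    with L.entropy_bound[OF w0, of ?n]
    show "\<bar>?f (u \<delta> ?n) - ?f z\<bar> \<le> norm w0 * (R + \<delta>0) + 3 * Q / c" by linarith
    \<comment> \<open>Here the lower bound on the stopping index enters: a <= n \<delta> converts
      the 1/n rate into a rate in \<delta>.\<close>
    have "a * (norm (L.r ?n))\<^sup>2 \<le> (?n * \<delta>) * (norm (L.r ?n))\<^sup>2"
      using k\<delta>(1) by (intro mult_right_mono) auto
    also have "\<dots> = \<delta> * (?n * (norm (L.r ?n))\<^sup>2)" by simp
    also have "\<dots> \<le> \<delta> * Q"
      using L.residual_rate[of ?n] P \<open>0 < \<delta>\<close> by (intro mult_left_mono) auto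
    finally show "(norm (ydelta \<delta> - A (u \<delta> ?n)))\<^sup>2 \<le> Q / a * \<delta>"
      using \<open>a > 0\<close> by (simp add: L.r_def field_simps)
    show "u \<delta> ?n \<in> dom_f \<Omega>" by (rule dom_subdiff_f_subset[OF L.u_dom])
  qed
  define B where "B = \<bar>?f z\<bar> + (norm w0 * (R + \<delta>0) + 3 * Q / c)"
  have f_bound: "\<bar>?f (u \<delta> (kstar \<delta>))\<bar> \<le> B" if "\<delta> \<in> {0<..\<delta>0}" for \<delta>
    using est(1)[OF that] unfolding B_def by linarith
  \<comment> \<open>Formulated for an arbitrary null sequence, so that it gives the second claim and
    also feeds the subsequence principle for the third.\<close>
  have subseq: "\<exists>r v. strict_mono r \<and> v \<in> L1 \<Omega> \<and> A v = y \<and>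
      weakly_converges_L1 \<Omega> (\<lambda>n. u (\<delta>s (r n)) (kstar (\<delta>s (r n)))) v sequentially"
    if \<delta>s: "\<And>n. \<delta>s n \<in> {0<..\<delta>0}" and lim: "\<delta>s \<longlonglongrightarrow> 0" for \<delta>s
  proof -
    obtain r v where r: "strict_mono (r :: nat \<Rightarrow> nat)"
      and weak: "weakly_converges_L1 \<Omega> (\<lambda>n. u (\<delta>s (r n)) (kstar (\<delta>s (r n)))) v sequentially"
      using entropy_weakly_compact[OF \<Omega>, of "\<lambda>n. u (\<delta>s n) (kstar (\<delta>s n))" B]
        est(3)[OF \<delta>s] f_bound[OF \<delta>s] by (metis abs_le_D1)
    have lim_r: "(\<lambda>n. \<delta>s (r n)) \<longlonglongrightarrow> 0"
      using LIMSEQ_subseq_LIMSEQ[OF lim r] by (simp add: o_def)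
    have "(\<lambda>n. A (u (\<delta>s (r n)) (kstar (\<delta>s (r n)))) - y) \<longlonglongrightarrow> 0"
    proof (rule Lim_null_comparison)
      have "norm (A (u \<delta> (kstar \<delta>)) - y) \<le> sqrt (Q / a * \<delta>) + \<delta>" if "\<delta> \<in> {0<..\<delta>0}" for \<delta>
      proof -
        have "norm (ydelta \<delta> - A (u \<delta> (kstar \<delta>))) \<le> sqrt (Q / a * \<delta>)"
          using est(2)[OF that] by (rule real_le_rsqrt)
        moreover have "norm (y - ydelta \<delta>) \<le> \<delta>" using assms(15) that by blast
        moreover have "norm (A (u \<delta> (kstar \<delta>)) - y) \<le>
            norm (ydelta \<delta> - A (u \<delta> (kstar \<delta>))) + norm (y - ydelta \<delta>)"
          using norm_triangle_ineq[of "ydelta \<delta> - A (u \<delta> (kstar \<delta>))" "y - ydelta \<delta>"]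
          by (simp add: norm_minus_commute)
        ultimately show ?thesis by linarith
      qed
      then show "\<forall>\<^sub>F n in sequentially. norm (A (u (\<delta>s (r n)) (kstar (\<delta>s (r n)))) - y)
          \<le> sqrt (Q / a * \<delta>s (r n)) + \<delta>s (r n)"
        using \<delta>s by simp
      have "(\<lambda>n. sqrt (Q / a * \<delta>s (r n)) + \<delta>s (r n)) \<longlonglongrightarrow> sqrt (Q / a * 0) + 0"
        by (intro tendsto_add tendsto_real_sqrt tendsto_mult tendsto_const lim_r)
      then show "(\<lambda>n. sqrt (Q / a * \<delta>s (r n)) + \<delta>s (r n)) \<longlonglongrightarrow> 0" by simp
    qed
    then have "(\<lambda>n. A (u (\<delta>s (r n)) (kstar (\<delta>s (r n))))) \<longlonglongrightarrow> y"
      by (rule LIM_zero_cancel)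
    then have "A v = y" by (intro weak_limit_solves[OF A weak]) auto
    then show ?thesis using r weak unfolding weakly_converges_L1_def by blast
  qed
  show ?thesis
  proof (intro conjI allI impI)
    show "\<exists>B. \<forall>\<delta>\<in>{0<..\<delta>0}. \<bar>neg_entropy \<Omega> (u \<delta> (kstar \<delta>))\<bar> \<le> ereal B"
      using f_bound by (intro exI[of _ B]) (simp add: dom_fD(5)[OF est(3)])
    show "\<exists>r v. strict_mono r \<and> v \<in> L1 \<Omega> \<and> A v = y \<and>
        weakly_converges_L1 \<Omega> (\<lambda>n. u (\<delta>s (r n)) (kstar (\<delta>s (r n)))) v sequentially"
      if "(\<forall>n. \<delta>s n \<in> {0<..\<delta>0}) \<and> \<delta>s \<longlonglongrightarrow> 0" for \<delta>s
      using that by (intro subseq) auto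
    assume unique: "\<forall>v\<in>L1 \<Omega>. A v = y \<longrightarrow> (AE t in lebesgue_on \<Omega>. v t = z t)"
    have zL1: "z \<in> L1 \<Omega>" using dom_fD(2)[OF assms(10)] .
    show "weakly_converges_L1 \<Omega> (\<lambda>\<delta>. u \<delta> (kstar \<delta>)) z (at_right 0)"
    proof (rule weakly_converges_at_right[OF assms(14) zL1])
      show "u \<delta> (kstar \<delta>) \<in> L1 \<Omega>" if "\<delta> \<in> {0<..\<delta>0}" for \<delta>
        using dom_fD(2)[OF est(3)[OF that]] .
      fix \<delta>s :: "nat \<Rightarrow> real" assume "\<And>n. \<delta>s n \<in> {0<..\<delta>0}" "\<delta>s \<longlonglongrightarrow> 0"
      from subseq[OF this]
      show "\<exists>r. strict_mono r \<and>
          weakly_converges_L1 \<Omega> (\<lambda>n. u (\<delta>s (r n)) (kstar (\<delta>s (r n)))) z sequentially"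
        using unique weakly_converges_L1_cong_limit[OF _ zL1] by blast
    qed
  qed
qed

end
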